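(* Let $\mathbb{H}^N$ be the Heisenberg group with homogeneous dimension $Q=2N+2$, let $\lambda\in\big(0,\big(\tfrac{Q-2}{2}\big)^2\big)$, $\gamma\in[0,1)$ and $\alpha\in(0,\infty)$. Assume that $$\int_{\mathbb{H}^N}\|\xi\|_H^{-\mu(\lambda)}u_0(\xi)\,d\xi<\infty,\qquad 0<\int_{\mathbb{H}^N}\|\xi\|_H^{-\mu(\lambda)}f(\xi)\,d\xi<\infty .$$ Then, for any $p>1$, the problem $$\partial_tu-\Delta_{H}u=\lambda \frac{\psi u}{\|\cdot\|_{H}^{2}}+\frac{1}{\Gamma(\gamma)}\int_0^t(t-\tau)^{\gamma-1}|u(\tau)|^{p}\,d\tau+t^\alpha f \ \text{ in } \mathbb{H}^N\times(0,T),\qquad u(\cdot,0)=u_0 \ \text{ in } \mathbb{H}^N,$$ does not admit a global-in-time weak solution.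
   Context: **Heisenberg group.** $\mathbb{H}^N$ is $\mathbb{R}^{2N+1}$ with points $\xi=(x,y,w)$, $x,y\in\mathbb{R}^N$, $w\in\mathbb{R}$, and group law $(x,y,w)\circ(x',y',w')=(x+x',y+y',w+w'+2\langle y,x'\rangle-2\langle x,y'\rangle)$. $Q=2N+2$. $d\xi$ is Lebesgue measure on $\mathbb{R}^{2N+1}$. Let $X_i=\partial_{x_i}+2y_i\partial_w$, $Y_i=\partial_{y_i}-2x_i\partial_w$ ($1\le i\le N$); $\nabla_H u=(X_1u,\dots,X_Nu,Y_1u,\dots,Y_Nu)$; $\Delta_H=\sum_{i=1}^N(X_i^2+Y_i^2)$; $\nabla_H\cdot$ denotes the corresponding horizontal divergence. The Korányi norm is $\|\xi\|_H=\big[\big(\sum_{i=1}^N(x_i^2+y_i^2)\big)^2+w^2\big]^{1/4}$, and $\psi=\big|\nabla_H\|\cdot\|_H\big|^2$. **Constant $\mu(\lambda)$.** For $\lambda\in(0,(\frac{Q-2}{2})^2)$, $\mu(\lambda)=\frac{Q-2}{2}-\sqrt{\big(\frac{Q-2}{2}\big)^2-\lambda}$. **Memory term.** For $\gamma\in(0,1)$, $I_{T^-}^\gamma\phi(t)=\frac{1}{\Gamma(\gamma)}\int_t^T(\tau-t)^{\gamma-1}\phi(\tau)\,d\tau$, and $I^0_{T^-}\phi=\phi$. Correspondingly, for $\gamma=0$ the term $\frac{1}{\Gamma(\gamma)}\int_0^t(t-\tau)^{\gamma-1}|u(\tau)|^p\,d\tau$ means $|u(t)|^p$. **Weak solution.**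 Put $v(\xi,t)=\|\xi\|_H^{\mu(\lambda)}u(\xi,t)$, $v(0,\xi)=\|\xi\|_H^{\mu(\lambda)}u_0(\xi)$, and $L_H\phi=-\nabla_H\cdot\big(\|\cdot\|_H^{-2\mu(\lambda)}\nabla_H\phi\big)$. Let $v(0,\cdot)\in L^1_{\rm loc}(\mathbb{H}^N,\|\xi\|_H^{-2\mu(\lambda)}d\xi)$ and $f\in L^1_{\rm loc}(\mathbb{H}^N,\|\xi\|_H^{-\mu(\lambda)}d\xi)$. The function $v\in L^p_{\rm loc}((0,T),L^p_{\rm loc}(\mathbb{H}^N,\|\xi\|_H^{-(p+1)\mu(\lambda)}d\xi))\cap L^1_{\rm loc}((0,T),L^1_{\rm loc}(\mathbb{H}^N,\|\xi\|_H^{-2\mu(\lambda)}d\xi))$ (equivalently $u$) is a local-in-time weak solution of the problem on $(0,T)$ if $$-\int_0^T\!\!\int_{\mathbb{H}^N}v\big(\|\xi\|_H^{-2\mu(\lambda)}\partial_t\phi-L_H\phi\big)d\xi dt=\int_0^T\!\!\int_{\mathbb{H}^N}\|\xi\|_H^{-(p+1)\mu(\lambda)}|v|^pI^\gamma_{T^-}\phi\,d\xi dt+\int_{\mathbb{H}^N}\|\xi\|_H^{-2\mu(\lambda)}v(0,\xi)\phi(0,\xi)d\xi+\int_0^T\!\!\int_{\mathbb{H}^N}\|\xi\|_H^{-\mu(\lambda)}t^\alpha f\phi\,d\xi dt$$ for every non-negative test function $\phi\in C_c^1([0,T),C_c^2(\mathbb{H}^N))$. It is a global-in-time weak solution if $T=\infty$.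 The integral conditions on $u_0$ and $f$ are understood as saying that these integrals exist as finite real numbers. *)

theory Defs
  imports "HOL-Analysis.Analysis"
begin

text \<open>The underlying space of the Heisenberg group, with points \<open>(x, y, w)\<close>; Lebesgue measure is
  \<^term>\<open>lebesgue\<close> on this Euclidean space. The group law itself is not needed below.\<close>

type_synonym 'n heisenberg = "(real ^ 'n) \<times> (real ^ 'n) \<times> real"

definition homdim :: "'n::finite itself \<Rightarrow> nat"
  where "homdim _ = 2 * CARD('n) + 2"

definition mu :: "nat \<Rightarrow> real \<Rightarrow> real"
  where "mu Q lam = (real Q - 2) / 2 - sqrt (((real Q - 2) / 2)\<^sup>2 - lam)"

definition koranyi :: "'n::finite heisenberg \<Rightarrow> real"
  where "koranyi = (\<lambda>(x, y, w). ((\<Sum>i\<in>UNIV. (x $ i)\<^sup>2 + (y $ i)\<^sup>2)\<^sup>2 + w\<^sup>2) powr (1 / 4))"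


subsection \<open>Horizontal differential operators\<close>

definition partial :: "'a::euclidean_space \<Rightarrow> ('a \<Rightarrow> real) \<Rightarrow> 'a \<Rightarrow> real"
  where "partial e g \<xi> = deriv (\<lambda>s. g (\<xi> + s *\<^sub>R e)) 0"

definition X_field :: "'n::finite \<Rightarrow> ('n heisenberg \<Rightarrow> real) \<Rightarrow> 'n heisenberg \<Rightarrow> real"
  where "X_field i g = (\<lambda>(x, y, w).
    partial (axis i 1, 0, 0) g (x, y, w) + 2 * y $ i * partial (0, 0, 1) g (x, y, w))"

definition Y_field :: "'n::finite \<Rightarrow> ('n heisenberg \<Rightarrow> real) \<Rightarrow> 'n heisenberg \<Rightarrow> real"
  where "Y_field i g = (\<lambda>(x, y, w).
    partial (0, axis i 1, 0) g (x, y, w) - 2 * x $ i * partial (0, 0, 1) g (x, y, w))"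

definition grad_H :: "('n::finite heisenberg \<Rightarrow> real) \<Rightarrow> 'n heisenberg \<Rightarrow> (real ^ 'n) \<times> (real ^ 'n)"
  where "grad_H g \<xi> = (\<chi> i. X_field i g \<xi>, \<chi> i. Y_field i g \<xi>)"

definition div_H :: "('n::finite heisenberg \<Rightarrow> (real ^ 'n) \<times> (real ^ 'n)) \<Rightarrow> 'n heisenberg \<Rightarrow> real"
  where "div_H F \<xi> =
    (\<Sum>i\<in>UNIV. X_field i (\<lambda>\<eta>. fst (F \<eta>) $ i) \<xi> + Y_field i (\<lambda>\<eta>. snd (F \<eta>) $ i) \<xi>)"

text \<open>At the origin the weight is singular and the value of \<open>L_H\<close> is arbitrary; the origin is a
  null set.\<close>

definition L_H :: "real \<Rightarrow> ('n::finite heisenberg \<Rightarrow> real) \<Rightarrow> 'n heisenberg \<Rightarrow> real"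
  where "L_H m g \<xi> = - div_H (\<lambda>\<eta>. (koranyi \<eta> powr (- 2 * m)) *\<^sub>R grad_H g \<eta>) \<xi>"


subsection \<open>Test functions\<close>

definition C1_fun :: "('a::euclidean_space \<Rightarrow> real) \<Rightarrow> bool"
  where "C1_fun g \<longleftrightarrow> (\<forall>e\<in>Basis.
    (\<forall>\<xi>. (\<lambda>s. g (\<xi> + s *\<^sub>R e)) differentiable at 0) \<and> continuous_on UNIV (partial e g))"

definition C2_fun :: "('a::euclidean_space \<Rightarrow> real) \<Rightarrow> bool"
  where "C2_fun g \<longleftrightarrow> C1_fun g \<and> (\<forall>e\<in>Basis. C1_fun (partial e g))"

text \<open>Convergence in the \<open>C\<^sup>2\<close> norm.\<close>

definition C2_limit ::
    "('b \<Rightarrow> 'a::euclidean_space \<Rightarrow> real) \<Rightarrow> ('a \<Rightarrow> real) \<Rightarrow> 'b filter \<Rightarrow> bool"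
  where "C2_limit G g F \<longleftrightarrow>
    uniform_limit UNIV G g F \<and>
    (\<forall>a\<in>Basis. uniform_limit UNIV (\<lambda>s. partial a (G s)) (partial a g) F) \<and>
    (\<forall>a\<in>Basis. \<forall>b\<in>Basis.
      uniform_limit UNIV (\<lambda>s. partial a (partial b (G s))) (partial a (partial b g)) F)"

text \<open>The class \<open>C\<^sub>c\<^sup>1([0,T), C\<^sub>c\<^sup>2)\<close>, where \<open>T\<close> may be \<open>\<infinity>\<close>; values of \<open>\<phi>\<close> at times outside \<open>[0,T)\<close>
  are ignored. The function \<open>\<phi>'\<close> is the time derivative of the \<open>C\<^sub>c\<^sup>2\<close>-valued curve \<open>\<phi>\<close>, one-sided
  at \<open>0\<close>. Since \<open>C\<^sub>c\<^sup>2\<close> carries the inductive limit topology of the spaces of \<open>C\<^sup>2\<close> functions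
  supported in a fixed compact set, a compactly supported continuous curve in it has all its values
  supported in one compact \<open>K\<close>.\<close>

definition test_function :: "ereal \<Rightarrow> (real \<Rightarrow> 'a::euclidean_space \<Rightarrow> real) \<Rightarrow> bool"
  where "test_function T \<phi> \<longleftrightarrow> (\<exists>\<phi>' K b. compact K \<and> ereal b < T \<and>
    (let I = {t. 0 \<le> t \<and> ereal t < T} in \<forall>t\<in>I.
      C2_fun (\<phi> t) \<and> C2_fun (\<phi>' t) \<and>
      (\<forall>\<xi>. b < t \<or> \<xi> \<notin> K \<longrightarrow> \<phi> t \<xi> = 0) \<and>
      C2_limit (\<lambda>s \<xi>. (\<phi> s \<xi> - \<phi> t \<xi>) / (s - t)) (\<phi>' t) (at t within I) \<and>
      C2_limit \<phi>' (\<phi>' t) (at t within I)))"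


subsection \<open>Weak solutions\<close>

definition frac_int :: "ereal \<Rightarrow> real \<Rightarrow> (real \<Rightarrow> real) \<Rightarrow> real \<Rightarrow> real"
  where "frac_int T gam h t =
    (if gam = 0 then h t
     else 1 / Gamma gam *
       (LINT \<tau>:{\<tau>. t < \<tau> \<and> ereal \<tau> < T}|lebesgue. (\<tau> - t) powr (gam - 1) * h \<tau>))"

text \<open>The weighted space \<open>L\<^sup>q\<^sub>l\<^sub>o\<^sub>c(\<real>\<^sup>d, k(\<xi>) d\<xi>)\<close>, and \<open>L\<^sup>q\<^sub>l\<^sub>o\<^sub>c((0,T), L\<^sup>q\<^sub>l\<^sub>o\<^sub>c(\<real>\<^sup>d, k(\<xi>) d\<xi>))\<close>.\<close>

definition Lloc :: "real \<Rightarrow> ('a::euclidean_space \<Rightarrow> real) \<Rightarrow> ('a \<Rightarrow> real) \<Rightarrow> bool"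
  where "Lloc q k g \<longleftrightarrow> g \<in> borel_measurable lebesgue \<and>
    (\<forall>K. compact K \<longrightarrow> set_integrable lebesgue K (\<lambda>\<xi>. k \<xi> * \<bar>g \<xi>\<bar> powr q))"

definition Lloc_time ::
    "ereal \<Rightarrow> real \<Rightarrow> ('a::euclidean_space \<Rightarrow> real) \<Rightarrow> (real \<Rightarrow> 'a \<Rightarrow> real) \<Rightarrow> bool"
  where "Lloc_time T q k v \<longleftrightarrow>
    set_borel_measurable lebesgue ({t. 0 < t \<and> ereal t < T} \<times> UNIV) (\<lambda>(t, \<xi>). v t \<xi>) \<and>
    (\<forall>J K. compact J \<and> J \<subseteq> {t. 0 < t \<and> ereal t < T} \<and> compact K \<longrightarrow>
      set_integrable lebesgue (J \<times> K) (\<lambda>(t, \<xi>). k \<xi> * \<bar>v t \<xi>\<bar> powr q))"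

text \<open>Weak formulation for \<open>v\<close>, with \<open>m = \<mu>(\<lambda>)\<close> and \<open>v0 = v(0,\<cdot>)\<close>. Bochner integrals of
  non-integrable functions are \<open>0\<close> by convention, so the convergence of the two space-time integrals
  involving \<open>v\<close> has to be demanded along with the identity: \<open>v\<close> is controlled neither near \<open>t = 0\<close>
  nor against the singularity of \<open>L_H m \<phi>\<close> at the origin. The other two integrals converge by local
  integrability of \<open>v0\<close> and \<open>f\<close>.\<close>

definition weak_solution_v ::
    "ereal \<Rightarrow> real \<Rightarrow> real \<Rightarrow> real \<Rightarrow> real \<Rightarrow> ('n::finite heisenberg \<Rightarrow> real) \<Rightarrow>
     ('n heisenberg \<Rightarrow> real) \<Rightarrow> (real \<Rightarrow> 'n heisenberg \<Rightarrow> real) \<Rightarrow> bool"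
  where "weak_solution_v T m gam alpha p f v0 v \<longleftrightarrow>
    0 < T \<and>
    Lloc 1 (\<lambda>\<xi>. koranyi \<xi> powr (- 2 * m)) v0 \<and>
    Lloc 1 (\<lambda>\<xi>. koranyi \<xi> powr (- m)) f \<and>
    Lloc_time T p (\<lambda>\<xi>. koranyi \<xi> powr (- (p + 1) * m)) v \<and>
    Lloc_time T 1 (\<lambda>\<xi>. koranyi \<xi> powr (- 2 * m)) v \<and>
    (\<forall>\<phi>. test_function T \<phi> \<and> (\<forall>t \<xi>. 0 \<le> t \<and> ereal t < T \<longrightarrow> 0 \<le> \<phi> t \<xi>) \<longrightarrow>
      (let D = {t. 0 < t \<and> ereal t < T} \<times> UNIV;
           A = (\<lambda>(t, \<xi>). v t \<xi> *
                 (koranyi \<xi> powr (- 2 * m) * deriv (\<lambda>s. \<phi> s \<xi>) t - L_H m (\<phi> t) \<xi>));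
           B = (\<lambda>(t, \<xi>). koranyi \<xi> powr (- (p + 1) * m) * \<bar>v t \<xi>\<bar> powr p *
                 frac_int T gam (\<lambda>s. \<phi> s \<xi>) t)
       in set_integrable lebesgue D A \<and> set_integrable lebesgue D B \<and>
          - (LINT z:D|lebesgue. A z) =
            (LINT z:D|lebesgue. B z) +
            (LINT \<xi>|lebesgue. koranyi \<xi> powr (- 2 * m) * v0 \<xi> * \<phi> 0 \<xi>) +
            (LINT (t, \<xi>):D|lebesgue. koranyi \<xi> powr (- m) * t powr alpha * f \<xi> * \<phi> t \<xi>)))"

text \<open>A weak solution \<open>u\<close> on \<open>(0,T)\<close> of
  \<open>\<partial>\<^sub>t u - \<Delta>\<^sub>H u = \<lambda> \<psi> u / \<parallel>\<xi>\<parallel>\<^sup>2 + I\<^sup>\<gamma>(|u|\<^sup>p) + t\<^sup>\<alpha> f\<close>, \<open>u(\<cdot>,0) = u\<^sub>0\<close>, is one whose transform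
  \<open>v = \<parallel>\<xi>\<parallel>\<^sup>\<mu> u\<close> is a weak solution of \<open>\<parallel>\<xi>\<parallel>\<^sup>-\<^sup>2\<^sup>\<mu> \<partial>\<^sub>t v + L_H v = \<parallel>\<xi>\<parallel>\<^sup>-\<^sup>\<mu> (I\<^sup>\<gamma>(|u|\<^sup>p) + t\<^sup>\<alpha> f)\<close>: for
  \<open>\<mu> = \<mu>(\<lambda>)\<close> the singular potential is absorbed into \<open>L_H\<close>.\<close>

definition weak_solution ::
    "ereal \<Rightarrow> real \<Rightarrow> real \<Rightarrow> real \<Rightarrow> real \<Rightarrow> ('n::finite heisenberg \<Rightarrow> real) \<Rightarrow>
     ('n heisenberg \<Rightarrow> real) \<Rightarrow> (real \<Rightarrow> 'n heisenberg \<Rightarrow> real) \<Rightarrow> bool"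
  where "weak_solution T lam gam alpha p f u0 u \<longleftrightarrow>
    (let m = mu (homdim TYPE('n)) lam in
      weak_solution_v T m gam alpha p f
        (\<lambda>\<xi>. koranyi \<xi> powr m * u0 \<xi>) (\<lambda>t \<xi>. koranyi \<xi> powr m * u t \<xi>))"

definition global_weak_solution ::
    "real \<Rightarrow> real \<Rightarrow> real \<Rightarrow> real \<Rightarrow> ('n::finite heisenberg \<Rightarrow> real) \<Rightarrow>
     ('n heisenberg \<Rightarrow> real) \<Rightarrow> (real \<Rightarrow> 'n heisenberg \<Rightarrow> real) \<Rightarrow> bool"
  where "global_weak_solution = weak_solution \<infinity>"

end

theory Submission imports Defs begin

text \<open>
  The proof tests the weak formulation with one fixed spatial profile and a time profile that is
  stretched to length \<open>T\<close>. Let \<open>\<phi>(t, \<xi>) = (1 - t/T)\<^sub>+\<^sup>k \<zeta>(\<xi>)\<close>, where \<open>\<zeta> = \<sigma>\<^sub>+\<^sup>k\<close> is a function of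
  the Koranyi norm supported in a fixed annulus. On an annulus all powers of the Koranyi norm are
  bounded above and away from zero, which removes the singularity of the weights at the origin. Write
  \<open>m = \<mu>(\<lambda>)\<close>.

  The right-hand side of the weak identity contains the nonlinear term
  \<open>\<integral>\<integral> \<parallel>\<xi>\<parallel>\<^sup>-\<^sup>(\<^sup>p\<^sup>+\<^sup>1\<^sup>)\<^sup>m |v|\<^sup>p I\<^sup>\<gamma>\<phi>\<close>, while the left-hand side is linear in \<open>v\<close>. The derivatives of a
  \<open>k\<close>-th power lose at most two factors, and \<open>I\<^sup>\<gamma>\<close> adds at most one factor \<open>1 - t/T\<close>, so for
  \<open>k (p - 1) \<ge> 2 p\<close> both \<open>|\<partial>\<^sub>t\<phi>|\<close> and \<open>|L_H \<phi>|\<close> are bounded by a constant times \<open>(I\<^sup>\<gamma>\<phi>)\<^sup>1\<^sup>/\<^sup>p\<close>,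
  uniformly in \<open>T \<ge> 1\<close>. Young's inequality then absorbs the linear terms into the nonlinear one, up
  to a bounded error supported in \<open>[0, T] \<times> annulus\<close>; this is \<open>weak_form_pointwise_absorption\<close>. What
  remains is, for all \<open>T \<ge> 1\<close>,
  \<open>T\<^sup>\<alpha>\<^sup>+\<^sup>1 Beta(\<alpha> + 1, k + 1) \<integral> \<parallel>\<xi>\<parallel>\<^sup>-\<^sup>m f \<zeta> d\<xi> + U \<le> C T\<close>,
  where the contribution \<open>U\<close> of the initial datum does not depend on \<open>T\<close>. As the annulus exhausts the
  punctured space, \<open>\<zeta>\<close> tends to \<open>1\<close>, so some annulus makes the integral of \<open>\<parallel>\<xi>\<parallel>\<^sup>-\<^sup>m f \<zeta>\<close> positive
  (\<open>annulus_cutoff_exhausts_integral\<close>). Since \<open>\<alpha> > 0\<close>, letting \<open>T \<rightarrow> \<infinity>\<close> is a contradiction.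

  The bound for \<open>L_H \<zeta>\<close> rests on an explicit formula: for a function of \<open>\<rho> = \<parallel>\<xi>\<parallel>\<^sup>4\<close>, a polynomial, the
  weighted horizontal Laplacian involves only derivatives of the one-variable profile and the
  polynomials \<open>|\<nabla>\<^sub>H \<rho>|\<^sup>2 = 16 \<rho> |(x, y)|\<^sup>2\<close> and \<open>\<Delta>\<^sub>H \<rho> = (8 N + 16) |(x, y)|\<^sup>2\<close> (\<open>L_H_radial\<close>).
\<close>

section \<open>The fourth power of the Koranyi norm\<close>

definition horizontal_sq :: "'n::finite heisenberg \<Rightarrow> real"
  where "horizontal_sq \<xi> = fst \<xi> \<bullet> fst \<xi> + fst (snd \<xi>) \<bullet> fst (snd \<xi>)"

text \<open>The fourth power of the Koranyi norm is a polynomial, so it can be differentiated at the origin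
  as well; all cutoffs and weights below are written as functions of it.\<close>

definition koranyi4 :: "'n::finite heisenberg \<Rightarrow> real"
  where "koranyi4 \<xi> = (horizontal_sq \<xi>)\<^sup>2 + (snd (snd \<xi>))\<^sup>2"

lemma koranyi_koranyi4: "koranyi \<xi> = koranyi4 \<xi> powr (1 / 4)"
proof -
  obtain x y w where [simp]: "\<xi> = (x, y, w)" by (cases \<xi>) auto
  have "(\<Sum>i\<in>UNIV. (x $ i)\<^sup>2 + (y $ i)\<^sup>2) = x \<bullet> x + y \<bullet> y"
    by (simp add: inner_vec_def sum.distrib power2_eq_square)
  then show ?thesis by (simp add: koranyi_def koranyi4_def horizontal_sq_def)
qed

lemma koranyi4_nonneg [simp]: "0 \<le> koranyi4 \<xi>"
  by (simp add: koranyi4_def)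

lemma horizontal_sq_nonneg [simp]: "0 \<le> horizontal_sq \<xi>"
  by (simp add: horizontal_sq_def)

lemma koranyi4_eq_0_iff [simp]: "koranyi4 \<xi> = 0 \<longleftrightarrow> \<xi> = 0"
proof -
  have "koranyi4 \<xi> = 0 \<longleftrightarrow> horizontal_sq \<xi> = 0 \<and> snd (snd \<xi>) = 0"
    unfolding koranyi4_def by (simp add: sum_power2_eq_zero_iff)
  also have "horizontal_sq \<xi> = 0 \<longleftrightarrow> fst \<xi> = 0 \<and> fst (snd \<xi>) = 0"
    unfolding horizontal_sq_def by (simp add: add_nonneg_eq_0_iff)
  finally show ?thesis by (auto simp: prod_eq_iff)
qed

lemma continuous_on_koranyi4 [continuous_intros]: "continuous_on A koranyi4"
  unfolding koranyi4_def horizontal_sq_def by (intro continuous_intros)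

lemma continuous_on_horizontal_sq [continuous_intros]: "continuous_on A horizontal_sq"
  unfolding horizontal_sq_def by (intro continuous_intros)

text \<open>Boundedness uses \<open>h \<le> 1 + h\<^sup>2\<close> for the horizontal part \<open>h\<close>, which compares the
  Euclidean norm with the anisotropic one.\<close>

lemma compact_koranyi4_annulus: "compact {\<xi>::'n::finite heisenberg. a \<le> koranyi4 \<xi> \<and> koranyi4 \<xi> \<le> b}"
proof (rule compact_eq_bounded_closed[THEN iffD2], rule conjI)
  have "norm \<xi> \<le> sqrt (2 + 2 * b)" if "koranyi4 \<xi> \<le> b" for \<xi> :: "'n heisenberg"
  proof -
    have "(norm \<xi>)\<^sup>2 = horizontal_sq \<xi> + (snd (snd \<xi>))\<^sup>2"
      unfolding horizontal_sq_def
      by (cases \<xi>) (simp add: norm_Pair power2_norm_eq_inner)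
    moreover have "0 \<le> (horizontal_sq \<xi> - 1)\<^sup>2" by simp
    then have "horizontal_sq \<xi> \<le> 1 + (horizontal_sq \<xi>)\<^sup>2"
      unfolding power2_diff by (smt (verit) horizontal_sq_nonneg one_power2)
    moreover have "0 \<le> (horizontal_sq \<xi>)\<^sup>2" "0 \<le> (snd (snd \<xi>))\<^sup>2" by simp_all
    ultimately have "(norm \<xi>)\<^sup>2 \<le> 2 + 2 * b" using that unfolding koranyi4_def by linarith
    then show ?thesis by (rule real_le_rsqrt)
  qed
  then show "bounded {\<xi>::'n heisenberg. a \<le> koranyi4 \<xi> \<and> koranyi4 \<xi> \<le> b}"
    unfolding bounded_iff by blast
  show "closed {\<xi>::'n heisenberg. a \<le> koranyi4 \<xi> \<and> koranyi4 \<xi> \<le> b}"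
    by (intro closed_Collect_conj closed_Collect_le continuous_intros)
qed

text \<open>The bilinear form polarising \<^const>\<open>horizontal_sq\<close>; it is needed to state directional
  derivatives of the polynomial in an arbitrary direction.\<close>

definition horizontal_inner :: "'n::finite heisenberg \<Rightarrow> 'n heisenberg \<Rightarrow> real"
  where "horizontal_inner \<xi> e = fst \<xi> \<bullet> fst e + fst (snd \<xi>) \<bullet> fst (snd e)"

definition koranyi4_deriv :: "'n::finite heisenberg \<Rightarrow> 'n heisenberg \<Rightarrow> real"
  where "koranyi4_deriv e \<xi> =
    4 * horizontal_sq \<xi> * horizontal_inner \<xi> e + 2 * snd (snd \<xi>) * snd (snd e)"

definition koranyi4_deriv2 :: "'n::finite heisenberg \<Rightarrow> 'n heisenberg \<Rightarrow> 'n heisenberg \<Rightarrow> real"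
  where "koranyi4_deriv2 a e \<xi> = 8 * horizontal_inner \<xi> a * horizontal_inner \<xi> e
    + 4 * horizontal_sq \<xi> * horizontal_inner a e + 2 * snd (snd a) * snd (snd e)"

lemma continuous_on_koranyi4_deriv [continuous_intros]:
  "continuous_on A (koranyi4_deriv e)" "continuous_on A (koranyi4_deriv2 a e)"
  unfolding koranyi4_deriv_def koranyi4_deriv2_def horizontal_inner_def
  by (intro continuous_intros)+

lemma horizontal_sq_line:
  "((\<lambda>s. horizontal_sq (\<xi> + s *\<^sub>R e)) has_real_derivative 2 * horizontal_inner \<xi> e) (at 0)"
  unfolding horizontal_sq_def horizontal_inner_def
  by (auto intro!: derivative_eq_intros simp: has_field_derivative_def inner_commute algebra_simps fun_eq_iff)

lemma horizontal_inner_line: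
  "((\<lambda>s. horizontal_inner (\<xi> + s *\<^sub>R a) e) has_real_derivative horizontal_inner a e) (at 0)"
  unfolding horizontal_inner_def
  by (auto intro!: derivative_eq_intros simp: has_field_derivative_def algebra_simps fun_eq_iff)

lemma vertical_line:
  "((\<lambda>s. snd (snd (\<xi> + s *\<^sub>R e))) has_real_derivative snd (snd (e::'n::finite heisenberg))) (at 0)"
  by (auto intro!: derivative_eq_intros simp: has_field_derivative_def algebra_simps fun_eq_iff)

lemma koranyi4_line: "((\<lambda>s. koranyi4 (\<xi> + s *\<^sub>R e)) has_real_derivative koranyi4_deriv e \<xi>) (at 0)"
  unfolding koranyi4_def koranyi4_deriv_def
  by (rule derivative_eq_intros horizontal_sq_line vertical_line refl | simp)+

lemma koranyi4_deriv_line: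
  "((\<lambda>s. koranyi4_deriv e (\<xi> + s *\<^sub>R a)) has_real_derivative koranyi4_deriv2 a e \<xi>) (at 0)"
  unfolding koranyi4_deriv_def koranyi4_deriv2_def
  by (rule derivative_eq_intros horizontal_sq_line horizontal_inner_line vertical_line refl | simp)+


section \<open>Horizontal calculus of radial functions\<close>

lemma koranyi4_comp_line:
  assumes "(\<theta> has_real_derivative D) (at (koranyi4 \<xi>))"
  shows "((\<lambda>s. \<theta> (koranyi4 (\<xi> + s *\<^sub>R e))) has_real_derivative D * koranyi4_deriv e \<xi>) (at 0)"
  using DERIV_chain2[OF _ koranyi4_line, of \<theta> D \<xi> e] assms by simp

lemma partial_eqI:
  assumes "((\<lambda>s. g (\<xi> + s *\<^sub>R e)) has_real_derivative D) (at 0)"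
  shows "partial e g \<xi> = D"
  unfolding partial_def using assms by (rule DERIV_imp_deriv)

lemma C1_funI:
  assumes "\<And>e \<xi>. e \<in> Basis \<Longrightarrow> ((\<lambda>s. g (\<xi> + s *\<^sub>R e)) has_real_derivative g' e \<xi>) (at 0)"
    and "\<And>e. e \<in> Basis \<Longrightarrow> continuous_on UNIV (g' e)"
  shows "C1_fun g"
  unfolding C1_fun_def
proof (intro ballI conjI allI)
  fix e :: 'a and \<xi> assume e: "e \<in> Basis"
  show "(\<lambda>s. g (\<xi> + s *\<^sub>R e)) differentiable at 0"
    using assms(1)[OF e] real_differentiable_def by blast
  have "partial e g = g' e" using assms(1)[OF e] partial_eqI by blast
  then show "continuous_on UNIV (partial e g)" using assms(2)[OF e] by simp
qed

text \<open>By the chain rule the second derivatives are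
  \<open>\<theta>''(\<rho>) \<partial>\<^sub>a\<rho> \<partial>\<^sub>b\<rho> + \<theta>'(\<rho>) \<partial>\<^sub>a\<partial>\<^sub>b\<rho>\<close>, with polynomial \<open>\<rho>\<close>. Only nonnegative arguments of \<open>\<theta>\<close>
  matter, which leaves room for profiles with a pole on the negative axis.\<close>

lemma C2_fun_radial:
  fixes \<theta> \<theta>' \<theta>'' :: "real \<Rightarrow> real"
  assumes d: "\<And>r. 0 \<le> r \<Longrightarrow> (\<theta> has_real_derivative \<theta>' r) (at r)"
    and d': "\<And>r. 0 \<le> r \<Longrightarrow> (\<theta>' has_real_derivative \<theta>'' r) (at r)"
    and c: "continuous_on {0..} \<theta>''"
  shows "C2_fun (\<lambda>\<xi>::'n::finite heisenberg. \<theta> (koranyi4 \<xi>))"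
proof -
  have c': "continuous_on {0..} \<theta>'"
    using d' by (intro continuous_at_imp_continuous_on) (auto intro: DERIV_isCont)
  note gc = continuous_on_compose2[OF c continuous_on_koranyi4] continuous_on_compose2[OF c' continuous_on_koranyi4]
  have l1: "((\<lambda>s. \<theta> (koranyi4 (\<xi> + s *\<^sub>R e))) has_real_derivative \<theta>' (koranyi4 \<xi>) * koranyi4_deriv e \<xi>) (at 0)"
    for \<xi> e :: "'n heisenberg" by (intro koranyi4_comp_line d koranyi4_nonneg)
  have l2: "((\<lambda>s. \<theta>' (koranyi4 (\<xi> + s *\<^sub>R a)) * koranyi4_deriv e (\<xi> + s *\<^sub>R a)) has_real_derivative
      \<theta>'' (koranyi4 \<xi>) * koranyi4_deriv a \<xi> * koranyi4_deriv e \<xi> + koranyi4_deriv2 a e \<xi> * \<theta>' (koranyi4 \<xi>)) (at 0)"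
    for \<xi> e a :: "'n heisenberg"
    by (rule derivative_eq_intros koranyi4_comp_line d' koranyi4_deriv_line koranyi4_nonneg refl | simp)+
  have p: "partial e (\<lambda>\<xi>. \<theta> (koranyi4 \<xi>)) = (\<lambda>\<xi>. \<theta>' (koranyi4 \<xi>) * koranyi4_deriv e \<xi>)"
    for e :: "'n heisenberg" using partial_eqI[OF l1] by blast
  have "C1_fun (\<lambda>\<xi>::'n heisenberg. \<theta> (koranyi4 \<xi>))"
    by (rule C1_funI[OF l1]) (intro continuous_intros gc; auto)
  moreover have "C1_fun (partial e (\<lambda>\<xi>::'n heisenberg. \<theta> (koranyi4 \<xi>)))" for e
    unfolding p by (rule C1_funI[OF l2]) (intro continuous_intros gc; auto)
  ultimately show ?thesis unfolding C2_fun_def by blast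
qed

text \<open>The weight \<open>\<parallel>\<xi>\<parallel>\<^sup>-\<^sup>2\<^sup>m\<close> is \<open>\<rho>\<^sup>-\<^sup>m\<^sup>/\<^sup>2\<close>, so the weighted gradient of \<open>\<theta>(\<rho>)\<close> is \<open>G(\<rho>) \<nabla>\<^sub>H \<rho>\<close> with
  \<open>G(r) = r\<^sup>-\<^sup>m\<^sup>/\<^sup>2 \<theta>'(r)\<close>, and its divergence is \<open>G'(\<rho>) |\<nabla>\<^sub>H \<rho>|\<^sup>2 + G(\<rho>) \<Delta>\<^sub>H \<rho>\<close>. Assuming
  differentiability of \<open>G\<close>, rather than of the weight, makes the formula hold at the origin for
  profiles that are constant there.\<close>

lemma L_H_radial:
  fixes \<xi> :: "'n::finite heisenberg"
  assumes d: "\<And>r. 0 \<le> r \<Longrightarrow> (\<theta> has_real_derivative \<theta>' r) (at r)"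
    and d': "\<And>r. 0 \<le> r \<Longrightarrow> ((\<lambda>r. r powr (- m / 2) * \<theta>' r) has_real_derivative G' r) (at r)"
  shows "L_H m (\<lambda>\<xi>. \<theta> (koranyi4 \<xi>)) \<xi> =
    - (G' (koranyi4 \<xi>) * (16 * koranyi4 \<xi> * horizontal_sq \<xi>) +
       koranyi4 \<xi> powr (- m / 2) * \<theta>' (koranyi4 \<xi>) * ((8 * real CARD('n) + 16) * horizontal_sq \<xi>))"
proof -
  define G where "G r = r powr (- m / 2) * \<theta>' r" for r
  have p: "partial e (\<lambda>\<xi>. \<theta> (koranyi4 \<xi>)) \<eta> = \<theta>' (koranyi4 \<eta>) * koranyi4_deriv e \<eta>"
    for e \<eta> :: "'n heisenberg" by (intro partial_eqI koranyi4_comp_line d koranyi4_nonneg)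
  have w: "koranyi \<eta> powr (- 2 * m) = koranyi4 \<eta> powr (- m / 2)" for \<eta> :: "'n heisenberg"
    by (simp add: koranyi_koranyi4 powr_powr)
  \<comment> \<open>The horizontal derivatives \<open>X\<^sub>i \<rho>\<close> and \<open>Y\<^sub>i \<rho>\<close>.\<close>
  define Xg Yg where "Xg i \<eta> = 4 * (horizontal_sq \<eta> * fst \<eta> $ i + fst (snd \<eta>) $ i * snd (snd \<eta>))"
    and "Yg i \<eta> = 4 * (horizontal_sq \<eta> * fst (snd \<eta>) $ i - fst \<eta> $ i * snd (snd \<eta>))"
    for i and \<eta> :: "'n heisenberg"
  have gX: "koranyi \<eta> powr (- 2 * m) * X_field i (\<lambda>\<xi>. \<theta> (koranyi4 \<xi>)) \<eta> = G (koranyi4 \<eta>) * Xg i \<eta>" 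
    and gY: "koranyi \<eta> powr (- 2 * m) * Y_field i (\<lambda>\<xi>. \<theta> (koranyi4 \<xi>)) \<eta> = G (koranyi4 \<eta>) * Yg i \<eta>" 
    for i and \<eta> :: "'n heisenberg"
    unfolding w X_field_def Y_field_def G_def Xg_def Yg_def
    by (auto simp: p koranyi4_deriv_def horizontal_inner_def inner_axis split: prod.splits)
       (simp_all add: algebra_simps)
  have lin: "((\<lambda>s. fst (\<xi> + s *\<^sub>R e) $ i) has_real_derivative fst e $ i) (at 0)"
    "((\<lambda>s. fst (snd (\<xi> + s *\<^sub>R e)) $ i) has_real_derivative fst (snd e) $ i) (at 0)"
    for e :: "'n heisenberg" and i
    by (auto intro!: derivative_eq_intros simp: has_field_derivative_def algebra_simps fun_eq_iff)
  have G: "(G has_real_derivative G' r) (at r)" if "0 \<le> r" for r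
    using d'[OF that] unfolding G_def .
  have lX: "((\<lambda>s. G (koranyi4 (\<xi> + s *\<^sub>R e)) * Xg i (\<xi> + s *\<^sub>R e)) has_real_derivative
      G' (koranyi4 \<xi>) * koranyi4_deriv e \<xi> * Xg i \<xi> + G (koranyi4 \<xi>) * (4 * (2 * horizontal_inner \<xi> e * fst \<xi> $ i
       + horizontal_sq \<xi> * fst e $ i + fst (snd e) $ i * snd (snd \<xi>) + fst (snd \<xi>) $ i * snd (snd e)))) (at 0)"
    for e :: "'n heisenberg" and i
    unfolding Xg_def
    by (rule derivative_eq_intros koranyi4_comp_line G lin horizontal_sq_line vertical_line koranyi4_nonneg refl
        | simp add: algebra_simps)+
  have lY: "((\<lambda>s. G (koranyi4 (\<xi> + s *\<^sub>R e)) * Yg i (\<xi> + s *\<^sub>R e)) has_real_derivative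
      G' (koranyi4 \<xi>) * koranyi4_deriv e \<xi> * Yg i \<xi> + G (koranyi4 \<xi>) * (4 * (2 * horizontal_inner \<xi> e * fst (snd \<xi>) $ i
       + horizontal_sq \<xi> * fst (snd e) $ i - fst e $ i * snd (snd \<xi>) - fst \<xi> $ i * snd (snd e)))) (at 0)"
    for e :: "'n heisenberg" and i
    unfolding Yg_def
    by (rule derivative_eq_intros koranyi4_comp_line G lin horizontal_sq_line vertical_line koranyi4_nonneg refl
        | simp add: algebra_simps)+
  obtain x y w where \<xi>: "\<xi> = (x, y, w)" by (cases \<xi>) auto
  have X: "X_field i (\<lambda>\<eta>. G (koranyi4 \<eta>) * Xg i \<eta>) \<xi> = G' (koranyi4 \<xi>) * (Xg i \<xi>)\<^sup>2 +
      G (koranyi4 \<xi>) * (4 * (2 * (x $ i)\<^sup>2 + horizontal_sq \<xi> + 2 * (y $ i)\<^sup>2))" for i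
    using partial_eqI[OF lX[of "(axis i 1, 0, 0)" i]] partial_eqI[OF lX[of "(0, 0, 1)" i]]
    unfolding \<xi> X_field_def
    by (simp add: horizontal_inner_def inner_axis koranyi4_deriv_def Xg_def)
       (simp add: algebra_simps power2_eq_square)
  have Y: "Y_field i (\<lambda>\<eta>. G (koranyi4 \<eta>) * Yg i \<eta>) \<xi> = G' (koranyi4 \<xi>) * (Yg i \<xi>)\<^sup>2 +
      G (koranyi4 \<xi>) * (4 * (2 * (y $ i)\<^sup>2 + horizontal_sq \<xi> + 2 * (x $ i)\<^sup>2))" for i
    using partial_eqI[OF lY[of "(0, axis i 1, 0)" i]] partial_eqI[OF lY[of "(0, 0, 1)" i]]
    unfolding \<xi> Y_field_def
    by (simp add: horizontal_inner_def inner_axis koranyi4_deriv_def Yg_def)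
       (simp add: algebra_simps power2_eq_square)
  have sq: "(\<Sum>i\<in>UNIV. (x $ i)\<^sup>2 + (y $ i)\<^sup>2) = horizontal_sq \<xi>"
    by (simp add: \<xi> horizontal_sq_def inner_vec_def sum.distrib power2_eq_square)
  \<comment> \<open>The mixed terms of the two squares cancel; this is where \<open>|\<nabla>\<^sub>H \<rho>|\<^sup>2\<close> becomes a multiple of \<open>\<rho>\<close>.\<close>
  have "(Xg i \<xi>)\<^sup>2 + (Yg i \<xi>)\<^sup>2 = 16 * koranyi4 \<xi> * ((x $ i)\<^sup>2 + (y $ i)\<^sup>2)" for i
    unfolding Xg_def Yg_def koranyi4_def by (simp add: \<xi> algebra_simps power2_eq_square)
  note squares = this
  have XY: "X_field i (\<lambda>\<eta>. G (koranyi4 \<eta>) * Xg i \<eta>) \<xi> + Y_field i (\<lambda>\<eta>. G (koranyi4 \<eta>) * Yg i \<eta>) \<xi>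
     = (G' (koranyi4 \<xi>) * 16 * koranyi4 \<xi> + G (koranyi4 \<xi>) * 16) * ((x $ i)\<^sup>2 + (y $ i)\<^sup>2)
       + G (koranyi4 \<xi>) * 8 * horizontal_sq \<xi>" for i
  proof -
    have "X_field i (\<lambda>\<eta>. G (koranyi4 \<eta>) * Xg i \<eta>) \<xi> + Y_field i (\<lambda>\<eta>. G (koranyi4 \<eta>) * Yg i \<eta>) \<xi>
      = G' (koranyi4 \<xi>) * ((Xg i \<xi>)\<^sup>2 + (Yg i \<xi>)\<^sup>2) +
        G (koranyi4 \<xi>) * (16 * ((x $ i)\<^sup>2 + (y $ i)\<^sup>2) + 8 * horizontal_sq \<xi>)"
      unfolding X Y by (simp add: ring_distribs)
    then show ?thesis unfolding squares by (simp add: ring_distribs mult.assoc)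
  qed
  have "L_H m (\<lambda>\<xi>. \<theta> (koranyi4 \<xi>)) \<xi> = - (\<Sum>i\<in>UNIV. X_field i (\<lambda>\<eta>. G (koranyi4 \<eta>) * Xg i \<eta>) \<xi>
     + Y_field i (\<lambda>\<eta>. G (koranyi4 \<eta>) * Yg i \<eta>) \<xi>)"
    unfolding L_H_def div_H_def grad_H_def
    by (simp only: fst_conv snd_conv fst_scaleR snd_scaleR vector_scaleR_component vec_lambda_beta
        real_scaleR_def gX gY)
  also have "\<dots> = - (G' (koranyi4 \<xi>) * (16 * koranyi4 \<xi> * horizontal_sq \<xi>) +
       G (koranyi4 \<xi>) * ((8 * real CARD('n) + 16) * horizontal_sq \<xi>))"
    unfolding XY sum.distrib[of _ "\<lambda>_. G (koranyi4 \<xi>) * 8 * horizontal_sq \<xi>"] sum_distrib_left[symmetric] sq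
    by (simp add: algebra_simps)
  finally show ?thesis unfolding G_def .
qed

section \<open>Products of a time profile and a spatial profile as test functions\<close>

lemma C1_fun_line:
  assumes "C1_fun g" "e \<in> Basis"
  shows "((\<lambda>s. g (\<xi> + s *\<^sub>R e)) has_real_derivative partial e g \<xi>) (at 0)"
  unfolding partial_def DERIV_deriv_iff_real_differentiable using assms unfolding C1_fun_def by simp

lemma partial_cmult:
  assumes "C1_fun g" "e \<in> Basis"
  shows "partial e (\<lambda>\<xi>. c * g \<xi>) = (\<lambda>\<xi>. c * partial e g \<xi>)"
  by (rule ext, rule partial_eqI, rule DERIV_cmult, rule C1_fun_line[OF assms])

lemma C1_fun_cmult:
  assumes "C1_fun g"
  shows "C1_fun (\<lambda>\<xi>. c * g \<xi>)"
proof (rule C1_funI)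
  show "((\<lambda>s. c * g (\<xi> + s *\<^sub>R e)) has_real_derivative c * partial e g \<xi>) (at 0)" if "e \<in> Basis" for e \<xi>
    by (rule DERIV_cmult, rule C1_fun_line[OF assms that])
  show "continuous_on UNIV (\<lambda>\<xi>. c * partial e g \<xi>)" if "e \<in> Basis" for e
    using assms that unfolding C1_fun_def by (intro continuous_intros) auto
qed

lemma C2_fun_cmult:
  assumes "C2_fun g"
  shows "C2_fun (\<lambda>\<xi>. c * g \<xi>)"
  unfolding C2_fun_def
proof (intro conjI ballI)
  have C1: "C1_fun g" "\<And>e. e \<in> Basis \<Longrightarrow> C1_fun (partial e g)"
    using assms unfolding C2_fun_def by simp_all
  show "C1_fun (\<lambda>\<xi>. c * g \<xi>)" by (rule C1_fun_cmult[OF C1(1)])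
  show "C1_fun (partial e (\<lambda>\<xi>. c * g \<xi>))" if "e \<in> Basis" for e
    unfolding partial_cmult[OF C1(1) that] by (rule C1_fun_cmult[OF C1(2)[OF that]])
qed

lemma partial_eq_0_outside:
  assumes "closed K" "\<And>\<xi>. \<xi> \<notin> K \<Longrightarrow> g \<xi> = 0" "\<xi> \<notin> K"
  shows "partial e g \<xi> = 0"
proof (rule partial_eqI)
  have "((\<lambda>s. \<xi> + s *\<^sub>R e) \<longlongrightarrow> \<xi> + 0 *\<^sub>R e) (nhds 0)"
    by (intro tendsto_intros filterlim_ident)
  then have "\<forall>\<^sub>F s in nhds 0. \<xi> + s *\<^sub>R e \<in> - K"
    by (rule topological_tendstoD) (use assms(1,3) in auto)
  then have "\<forall>\<^sub>F s in nhds 0. g (\<xi> + s *\<^sub>R e) = 0"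
    by (rule eventually_mono) (simp add: assms(2))
  then show "((\<lambda>s. g (\<xi> + s *\<^sub>R e)) has_real_derivative 0) (at 0)"
    by (subst DERIV_cong_ev[OF refl _ refl, of _ "\<lambda>_. 0"]) auto
qed

lemma bounded_of_compact_support:
  fixes g :: "'a::topological_space \<Rightarrow> real"
  assumes "compact K" "continuous_on UNIV g" "\<And>\<xi>. \<xi> \<notin> K \<Longrightarrow> g \<xi> = 0"
  shows "\<exists>B. \<forall>\<xi>. \<bar>g \<xi>\<bar> \<le> B"
proof -
  have "compact (g ` K)"
    using assms(1) continuous_on_subset[OF assms(2)] by (intro compact_continuous_image) auto
  then have "bounded (g ` K)" by (rule compact_imp_bounded)
  then obtain B where B: "\<forall>\<xi>\<in>K. \<bar>g \<xi>\<bar> \<le> B"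
    unfolding bounded_iff by auto
  have "\<bar>g \<xi>\<bar> \<le> max B 0" for \<xi>
    using B[rule_format, of \<xi>] assms(3)[of \<xi>] by (cases "\<xi> \<in> K") auto
  then show ?thesis by blast
qed

lemma uniform_limit_cmult:
  fixes c :: "'b \<Rightarrow> real"
  assumes "(c \<longlongrightarrow> c0) F" "\<exists>B. \<forall>\<xi>. \<bar>g \<xi>\<bar> \<le> B"
  shows "uniform_limit UNIV (\<lambda>s \<xi>. c s * g \<xi>) (\<lambda>\<xi>. c0 * g \<xi>) F"
  unfolding uniform_limit_iff
proof (intro allI impI)
  fix e :: real assume e: "0 < e"
  obtain B where B: "\<forall>\<xi>. \<bar>g \<xi>\<bar> \<le> B" using assms(2) by blast
  have Bp: "0 \<le> B" using B[rule_format, of undefined] by linarith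
  have "\<forall>\<^sub>F s in F. dist (c s) c0 < e / (B + 1)"
    using assms(1) e Bp by (intro tendstoD) auto
  then show "\<forall>\<^sub>F s in F. \<forall>\<xi>\<in>UNIV. dist (c s * g \<xi>) (c0 * g \<xi>) < e"
  proof (eventually_elim, intro ballI)
    fix s \<xi> assume s: "dist (c s) c0 < e / (B + 1)"
    have "dist (c s * g \<xi>) (c0 * g \<xi>) = dist (c s) c0 * \<bar>g \<xi>\<bar>"
      by (simp add: dist_real_def left_diff_distrib[symmetric] abs_mult)
    also have "\<dots> \<le> dist (c s) c0 * (B + 1)"
      using B[rule_format, of \<xi>] by (intro mult_left_mono) auto
    also have "\<dots> < e" using s Bp by (simp add: field_simps)
    finally show "dist (c s * g \<xi>) (c0 * g \<xi>) < e" .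
  qed
qed

text \<open>A curve that moves only along the line spanned by one \<open>C\<^sub>c\<^sup>2\<close> function converges in \<open>C\<^sup>2\<close> as soon
  as its scalar coefficient does, because the function and its derivatives up to order two are
  bounded.\<close>

lemma C2_limit_cmult:
  assumes g: "C2_fun g" "continuous_on UNIV g" and K: "compact K" "\<And>\<xi>. \<xi> \<notin> K \<Longrightarrow> g \<xi> = 0"
    and c: "(c \<longlongrightarrow> c0) F"
  shows "C2_limit (\<lambda>s \<xi>. c s * g \<xi>) (\<lambda>\<xi>. c0 * g \<xi>) F"
proof -
  have C1: "C1_fun g" "\<And>b. b \<in> Basis \<Longrightarrow> C1_fun (partial b g)"
    using g unfolding C2_fun_def by auto
  have s1: "partial b g \<xi> = 0" if "\<xi> \<notin> K" for b \<xi>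
    by (rule partial_eq_0_outside[OF compact_imp_closed[OF K(1)] K(2) that])
  have s2: "partial a (partial b g) \<xi> = 0" if "\<xi> \<notin> K" for a b \<xi>
    by (rule partial_eq_0_outside[OF compact_imp_closed[OF K(1)] s1 that])
  show ?thesis
    unfolding C2_limit_def
  proof (intro conjI ballI)
    show "uniform_limit UNIV (\<lambda>s \<xi>. c s * g \<xi>) (\<lambda>\<xi>. c0 * g \<xi>) F"
      by (rule uniform_limit_cmult[OF c bounded_of_compact_support[OF K(1) g(2) K(2)]])
  next
    fix b :: 'a assume b: "b \<in> Basis"
    have cont: "continuous_on UNIV (partial b g)" using C1(1) b unfolding C1_fun_def by simp
    show "uniform_limit UNIV (\<lambda>s. partial b (\<lambda>\<xi>. c s * g \<xi>)) (partial b (\<lambda>\<xi>. c0 * g \<xi>)) F"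
      unfolding partial_cmult[OF C1(1) b]
      by (rule uniform_limit_cmult[OF c bounded_of_compact_support[OF K(1) cont s1]])
  next
    fix a b :: 'a assume a: "a \<in> Basis" and b: "b \<in> Basis"
    have cont: "continuous_on UNIV (partial a (partial b g))" using C1(2)[OF b] a unfolding C1_fun_def by simp
    show "uniform_limit UNIV (\<lambda>s. partial a (partial b (\<lambda>\<xi>. c s * g \<xi>)))
        (partial a (partial b (\<lambda>\<xi>. c0 * g \<xi>))) F"
      unfolding partial_cmult[OF C1(1) b] partial_cmult[OF C1(2)[OF b] a]
      by (rule uniform_limit_cmult[OF c bounded_of_compact_support[OF K(1) cont s2]])
  qed
qed

lemma test_function_product:
  assumes g: "C2_fun g" "continuous_on UNIV g" and K: "compact K" "\<And>\<xi>. \<xi> \<notin> K \<Longrightarrow> g \<xi> = 0"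
    and d: "\<And>t. (\<eta> has_real_derivative \<eta>' t) (at t)" and c: "\<And>t. isCont \<eta>' t"
    and b: "\<And>t. b < t \<Longrightarrow> \<eta> t = 0"
  shows "test_function \<infinity> (\<lambda>t \<xi>. \<eta> t * g \<xi>)"
proof -
  have q: "C2_limit (\<lambda>s \<xi>. (\<eta> s * g \<xi> - \<eta> t * g \<xi>) / (s - t)) (\<lambda>\<xi>. \<eta>' t * g \<xi>) (at t within I)" for t I
  proof -
    have "((\<lambda>s. (\<eta> s - \<eta> t) / (s - t)) \<longlongrightarrow> \<eta>' t) (at t within I)"
      using has_field_derivative_at_within[OF d] unfolding has_field_derivative_iff .
    from C2_limit_cmult[OF g K this] show ?thesis
      by (simp add: left_diff_distrib)
  qed
  moreover have "C2_limit (\<lambda>s \<xi>. \<eta>' s * g \<xi>) (\<lambda>\<xi>. \<eta>' t * g \<xi>) (at t within I)" for t I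
  proof (rule C2_limit_cmult[OF g K])
    show "(\<eta>' \<longlongrightarrow> \<eta>' t) (at t within I)"
      unfolding continuous_within[symmetric] by (rule continuous_at_imp_continuous_at_within[OF c])
  qed
  moreover have "C2_fun (\<lambda>\<xi>. \<eta> t * g \<xi>)" "C2_fun (\<lambda>\<xi>. \<eta>' t * g \<xi>)" for t
    by (rule C2_fun_cmult[OF g(1)])+
  moreover have "\<eta> t * g \<xi> = 0" if "b < t \<or> \<xi> \<notin> K" for t \<xi>
    using b K(2) that by auto
  ultimately show ?thesis
    unfolding test_function_def Let_def using K(1)
    by (intro exI[of _ "\<lambda>t \<xi>. \<eta>' t * g \<xi>"] exI[of _ K] exI[of _ b]) simp
qed

section \<open>A cutoff onto a Koranyi annulus\<close>

text \<open>At \<open>0\<close> Caratheodory's criterion applies: the difference quotient there is \<open>(max 0 z)\<^sup>k\<^sup>-\<^sup>1\<close>, which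
  is continuous and vanishes.\<close>

lemma pos_part_power_deriv:
  assumes "2 \<le> k"
  shows "((\<lambda>x::real. max 0 x ^ k) has_real_derivative real k * max 0 x ^ (k - 1)) (at x)"
proof -
  obtain n where k: "k = Suc (Suc n)"
    using assms by (metis Suc_le_D numeral_2_eq_2 Suc_le_mono)
  consider "x < 0" | "x > 0" | "x = 0" by linarith
  then show ?thesis
  proof cases
    case 1
    have "((\<lambda>x::real. 0) has_real_derivative 0) (at x)" by simp
    then have "((\<lambda>x::real. max 0 x ^ k) has_real_derivative 0) (at x)"
      by (rule has_field_derivative_transform_within_open[where S="{..<0}"]) (use 1 assms in auto)
    then show ?thesis using 1 k by simp
  next
    case 2
    have "((\<lambda>x::real. x ^ k) has_real_derivative real k * x ^ (k - 1)) (at x)"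
      using DERIV_pow[of k x UNIV] by simp
    then have "((\<lambda>x::real. max 0 x ^ k) has_real_derivative real k * x ^ (k - 1)) (at x)"
      by (rule has_field_derivative_transform_within_open[where S="{0<..}"]) (use 2 in auto)
    then show ?thesis using 2 by simp
  next
    case 3
    have "\<exists>g. (\<forall>z. max 0 z ^ k - max 0 0 ^ k = g z * (z - 0)) \<and> isCont g (0::real) \<and> g 0 = 0"
    proof (intro exI[of _ "\<lambda>z. max 0 z ^ (k - 1)"] conjI allI)
      fix z :: real
      show "max 0 z ^ k - max 0 0 ^ k = max 0 z ^ (k - 1) * (z - 0)"
        using k by (cases "z \<le> 0") auto
      show "isCont (\<lambda>z. max 0 z ^ (k - 1)) (0::real)" by (intro continuous_intros)
      show "max 0 (0::real) ^ (k - 1) = 0" using k by auto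
    qed
    then have "((\<lambda>x::real. max 0 x ^ k) has_real_derivative 0) (at 0)"
      unfolding CARAT_DERIV by blast
    then show ?thesis using 3 k by simp
  qed
qed

text \<open>A \<open>C\<^sup>2\<close> function on the half line that is negative near \<open>0\<close> (its value there is \<open>-1\<close>) and for
  \<open>r \<ge> j\<close>, at most \<open>1\<close>, and tends to \<open>1\<close> pointwise on \<open>r > 0\<close> as \<open>j \<rightarrow> \<infinity>\<close>. Powers of its positive
  part are therefore cutoffs onto annuli that exhaust the punctured space.\<close>

definition annulus_profile :: "real \<Rightarrow> real \<Rightarrow> real"
  where "annulus_profile j r = 1 - r / j - 2 / (1 + j * r)"

definition annulus_profile' :: "real \<Rightarrow> real \<Rightarrow> real"
  where "annulus_profile' j r = - 1 / j + 2 * j / (1 + j * r)\<^sup>2"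

definition annulus_profile'' :: "real \<Rightarrow> real \<Rightarrow> real"
  where "annulus_profile'' j r = - 4 * j\<^sup>2 / (1 + j * r) ^ 3"

lemma annulus_profile_deriv:
  assumes "0 < j" "0 \<le> r"
  shows "(annulus_profile j has_real_derivative annulus_profile' j r) (at r)"
    and "(annulus_profile' j has_real_derivative annulus_profile'' j r) (at r)"
proof -
  have "0 < 1 + j * r" using assms by (simp add: add_pos_nonneg)
  then have nz: "1 + j * r \<noteq> 0" "j \<noteq> 0" using assms by simp_all
  show "(annulus_profile j has_real_derivative annulus_profile' j r) (at r)"
    unfolding annulus_profile_def[abs_def] annulus_profile'_def using nz
    by (auto intro!: derivative_eq_intros simp: power2_eq_square)
  show "(annulus_profile' j has_real_derivative annulus_profile'' j r) (at r)"
    unfolding annulus_profile'_def[abs_def] annulus_profile''_def using nz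
    by (auto intro!: derivative_eq_intros simp: power2_eq_square) (simp add: power3_eq_cube divide_simps)
qed

lemma annulus_profile_le_1: "0 < j \<Longrightarrow> 0 \<le> r \<Longrightarrow> annulus_profile j r \<le> 1"
  unfolding annulus_profile_def by (smt (verit) divide_nonneg_nonneg mult_nonneg_nonneg)

lemma annulus_profile_pos:
  assumes "0 < j" "0 \<le> r" "0 < annulus_profile j r"
  shows "1 / j < r" "r < j"
proof -
  have p: "0 < 1 + j * r" using assms by (simp add: add_pos_nonneg)
  have "0 \<le> r / j" "0 < 2 / (1 + j * r)" using assms p by auto
  then have "r / j < 1" "2 / (1 + j * r) < 1" using assms(3) unfolding annulus_profile_def by linarith+
  then show "1 / j < r" "r < j" using p assms by (simp_all add: field_simps)
qed

lemma annulus_profile_tendsto: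
  assumes "0 < r"
  shows "((\<lambda>n. annulus_profile (real n) r) \<longlongrightarrow> 1) sequentially"
proof -
  have "((\<lambda>n. 1 - r / real n - 2 / (1 + real n * r)) \<longlongrightarrow> 1 - 0 - 0) sequentially"
    by (intro tendsto_intros tendsto_divide_0[OF tendsto_const] filterlim_at_top_imp_at_infinity
        filterlim_tendsto_add_at_top[OF tendsto_const]
        filterlim_at_top_mult_tendsto_pos[OF tendsto_const assms]
        filterlim_real_sequentially)
  then show ?thesis by (simp add: annulus_profile_def)
qed

definition annulus_cutoff :: "nat \<Rightarrow> real \<Rightarrow> 'n::finite heisenberg \<Rightarrow> real"
  where "annulus_cutoff k j \<xi> = max 0 (annulus_profile j (koranyi4 \<xi>)) ^ k"

lemma annulus_cutoff_radial_deriv: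
  fixes k :: nat and j :: real
  defines "\<theta>' \<equiv> \<lambda>r. real k * max 0 (annulus_profile j r) ^ (k - 1) * annulus_profile' j r"
    and "\<theta>'' \<equiv> \<lambda>r. real k * (real (k - 1) * max 0 (annulus_profile j r) ^ (k - 2) * (annulus_profile' j r)\<^sup>2
        + max 0 (annulus_profile j r) ^ (k - 1) * annulus_profile'' j r)"
  assumes "3 \<le> k" "0 < j" "0 \<le> r"
  shows "((\<lambda>r. max 0 (annulus_profile j r) ^ k) has_real_derivative \<theta>' r) (at r)"
    and "(\<theta>' has_real_derivative \<theta>'' r) (at r)"
proof -
  have chain: "((\<lambda>r. max 0 (annulus_profile j r) ^ n) has_real_derivative
      real n * max 0 (annulus_profile j r) ^ (n - 1) * annulus_profile' j r) (at r)" if "2 \<le> n" for n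
    using DERIV_chain2[OF pos_part_power_deriv[OF that] annulus_profile_deriv(1)[OF assms(4,5)]] .
  show "((\<lambda>r. max 0 (annulus_profile j r) ^ k) has_real_derivative \<theta>' r) (at r)"
    unfolding \<theta>'_def by (rule chain) (use assms in auto)
  have "2 \<le> k - 1" "k - 1 - 1 = k - 2" using assms(3) by simp_all
  then show "(\<theta>' has_real_derivative \<theta>'' r) (at r)"
    using DERIV_mult[OF DERIV_cmult[OF chain[of "k - 1"], of "real k"] annulus_profile_deriv(2)[OF assms(4,5)]]
    unfolding \<theta>'_def \<theta>''_def by (simp only: power2_eq_square) (simp add: algebra_simps)
qed

lemma annulus_cutoff_support:
  assumes "0 < j" "1 \<le> k" "\<xi> \<notin> {\<xi>. 1 / j \<le> koranyi4 \<xi> \<and> koranyi4 \<xi> \<le> j}"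
  shows "annulus_profile j (koranyi4 \<xi>) \<le> 0" "annulus_cutoff k j \<xi> = 0"
proof -
  show *: "annulus_profile j (koranyi4 \<xi>) \<le> 0"
    using annulus_profile_pos[OF assms(1) koranyi4_nonneg[of \<xi>]] assms(3) by fastforce
  show "annulus_cutoff k j \<xi> = 0" using * assms(2) by (simp add: annulus_cutoff_def)
qed

lemma continuous_on_annulus_profile [continuous_intros]:
  assumes "0 < j"
  shows "continuous_on {0..} (annulus_profile j)" "continuous_on {0..} (annulus_profile' j)"
    "continuous_on {0..} (annulus_profile'' j)"
proof -
  have nz: "1 + j * r \<noteq> 0" if "r \<in> {0..}" for r
  proof -
    have "0 \<le> j * r" using assms that by simp
    then show ?thesis by linarith
  qed
  show "continuous_on {0..} (annulus_profile j)" "continuous_on {0..} (annulus_profile' j)"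
    "continuous_on {0..} (annulus_profile'' j)"
    unfolding annulus_profile_def[abs_def] annulus_profile'_def[abs_def] annulus_profile''_def[abs_def]
    using assms nz by (auto intro!: continuous_intros)
qed

lemma C2_fun_annulus_cutoff:
  assumes "3 \<le> k" "0 < j"
  shows "C2_fun (annulus_cutoff k j :: 'n::finite heisenberg \<Rightarrow> real)"
    and "continuous_on UNIV (annulus_cutoff k j :: 'n heisenberg \<Rightarrow> real)"
proof -
  show "C2_fun (annulus_cutoff k j :: 'n::finite heisenberg \<Rightarrow> real)"
    unfolding annulus_cutoff_def[abs_def]
    by (rule C2_fun_radial[OF annulus_cutoff_radial_deriv[OF assms]])
       (auto intro!: continuous_intros assms)
  show "continuous_on UNIV (annulus_cutoff k j :: 'n heisenberg \<Rightarrow> real)"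
    unfolding annulus_cutoff_def[abs_def]
    by (intro continuous_intros continuous_on_compose2[OF continuous_on_annulus_profile(1)[OF assms(2)] continuous_on_koranyi4]) auto
qed

text \<open>Two derivatives of \<open>\<sigma>\<^sub>+\<^sup>k\<close> leave a factor \<open>\<sigma>\<^sub>+\<^sup>k\<^sup>-\<^sup>2\<close>; the cofactor is continuous on the compact
  annulus, hence bounded. The scalar \<open>c\<close> stands for the value of the time profile.\<close>

lemma L_H_annulus_cutoff_bound:
  assumes "3 \<le> k" "0 < j"
  shows "\<exists>C\<ge>0. \<forall>c. \<forall>\<xi>::'n::finite heisenberg. \<bar>L_H m (\<lambda>\<eta>. c * annulus_cutoff k j \<eta>) \<xi>\<bar>
    \<le> C * \<bar>c\<bar> * max 0 (annulus_profile j (koranyi4 \<xi>)) ^ (k - 2)"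
proof -
  obtain n where k: "k = Suc (Suc (Suc n))"
    using le_Suc_ex[OF assms(1)] by (auto simp: numeral_3_eq_3)
  define s where "s r = max 0 (annulus_profile j r)" for r
  define \<theta>' where "\<theta>' r = real k * s r ^ (k - 1) * annulus_profile' j r" for r
  define \<theta>'' where "\<theta>'' r = real k * (real (k - 1) * s r ^ (k - 2) * (annulus_profile' j r)\<^sup>2
        + s r ^ (k - 1) * annulus_profile'' j r)" for r
  note \<theta> = annulus_cutoff_radial_deriv[OF assms, folded s_def, folded \<theta>'_def \<theta>''_def]
  \<comment> \<open>The derivative of \<open>r\<^sup>-\<^sup>m\<^sup>/\<^sup>2 \<theta>'(r)\<close>. It is correct at \<open>r = 0\<close> too: both sides vanish near \<open>0\<close>, where \<open>0 powr q = 0\<close>.\<close>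
  define G' where "G' r = - m / 2 * r powr (- m / 2 - 1) * \<theta>' r + r powr (- m / 2) * \<theta>'' r" for r
  have s0: "s r = 0" if "0 \<le> r" "r \<le> 1 / j" for r
    using annulus_profile_pos(1)[OF assms(2) that(1)] that(2) unfolding s_def by fastforce
  have G: "((\<lambda>r. r powr (- m / 2) * \<theta>' r) has_real_derivative G' r) (at r)" if "0 \<le> r" for r
  proof (cases "r = 0")
    case False
    then have "0 < r" using that by simp
    then show ?thesis unfolding G'_def
      by (auto intro!: derivative_eq_intros \<theta>(2))
  next
    case True
    have "((\<lambda>r::real. 0) has_real_derivative 0) (at 0)" by simp
    then have "((\<lambda>r. r powr (- m / 2) * \<theta>' r) has_real_derivative 0) (at 0)"
    \<comment> \<open>On this neighbourhood of \<open>0\<close> the profile is nonpositive: on the left part \<open>0 < 1 + j r < 1\<close> and \<open>- r/j < 1\<close>.\<close>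
    proof (rule has_field_derivative_transform_within_open[where S="{- min (1 / j) j<..<1 / j}"])
      fix r assume r: "r \<in> {- min (1 / j) j<..<1 / j}"
      show "0 = r powr (- m / 2) * \<theta>' r"
      proof (cases "0 \<le> r")
        case True
        then show ?thesis using s0[of r] r k by (simp add: \<theta>'_def)
      next
        case False
        have r': "- (1 / j) < r" "- j < r" using r by auto
        have "- 1 < j * r" using mult_strict_left_mono[OF r'(1) assms(2)] assms(2) by simp
        moreover have "j * r < 0" using assms(2) False by (intro mult_pos_neg) auto
        ultimately have "0 < 1 + j * r" "1 + j * r < 1" by simp_all
        then have "2 / (1 + j * r) > 2" by (simp add: field_simps)
        moreover have "- (r / j) < 1" using r'(2) assms(2) by (simp add: field_simps)
        ultimately have "annulus_profile j r < 0" unfolding annulus_profile_def by linarith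
        then show ?thesis using k by (simp add: \<theta>'_def s_def)
      qed
    qed (use assms in auto)
    then show ?thesis using True by (simp add: G'_def)
  qed
  define A where "A r = real k * s r * annulus_profile' j r" for r
  define B where "B r = real k * (real (k - 1) * (annulus_profile' j r)\<^sup>2 + s r * annulus_profile'' j r)" for r
  have \<theta>'_factor: "\<theta>' r = s r ^ (k - 2) * A r" and \<theta>''_factor: "\<theta>'' r = s r ^ (k - 2) * B r" for r
    unfolding \<theta>'_def \<theta>''_def A_def B_def k by (simp_all add: distrib_left)
  \<comment> \<open>The cofactor of \<open>c s\<^sup>k\<^sup>-\<^sup>2\<close> in \<open>L_H\<close>.\<close>
  define H where "H \<xi> = - ((- m / 2 * koranyi4 \<xi> powr (- m / 2 - 1) * A (koranyi4 \<xi>)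
     + koranyi4 \<xi> powr (- m / 2) * B (koranyi4 \<xi>)) * (16 * koranyi4 \<xi> * horizontal_sq \<xi>)
     + koranyi4 \<xi> powr (- m / 2) * A (koranyi4 \<xi>)
       * ((8 * real CARD('n) + 16) * horizontal_sq \<xi>))" for \<xi> :: "'n heisenberg"
  have LH: "L_H m (\<lambda>\<eta>. c * annulus_cutoff k j \<eta>) \<xi> = c * s (koranyi4 \<xi>) ^ (k - 2) * H \<xi>"
    for c and \<xi> :: "'n heisenberg"
  proof -
    have "L_H m (\<lambda>\<eta>. c * s (koranyi4 \<eta>) ^ k) \<xi> = 
      - (c * G' (koranyi4 \<xi>) * (16 * koranyi4 \<xi> * horizontal_sq \<xi>) +
       koranyi4 \<xi> powr (- m / 2) * (c * \<theta>' (koranyi4 \<xi>)) * ((8 * real CARD('n) + 16) * horizontal_sq \<xi>))"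
    proof (rule L_H_radial)
      show "((\<lambda>r. r powr (- m / 2) * (c * \<theta>' r)) has_real_derivative c * G' r) (at r)" if "0 \<le> r" for r
        using DERIV_cmult[OF G[OF that], of c] by (simp add: mult_ac)
    qed (intro DERIV_cmult \<theta>(1))
    then show ?thesis
      unfolding annulus_cutoff_def s_def[symmetric] H_def G'_def \<theta>'_factor \<theta>''_factor
      by (simp only: minus_mult_right[symmetric] distrib_left distrib_right mult_ac minus_add_distrib)
  qed
  define K where "K = {\<xi>::'n heisenberg. 1 / j \<le> koranyi4 \<xi> \<and> koranyi4 \<xi> \<le> j}"
  have "continuous_on K H"
  proof -
    have nz: "koranyi4 \<xi> \<noteq> 0" if "\<xi> \<in> K" for \<xi>
      using that assms(2) unfolding K_def by (smt (verit) divide_pos_pos mem_Collect_eq)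
    note comp = continuous_on_compose2[OF _ continuous_on_koranyi4]
    show ?thesis
      unfolding H_def[abs_def] A_def B_def s_def
      by (intro continuous_intros comp[OF continuous_on_annulus_profile(1)[OF assms(2)]]
          comp[OF continuous_on_annulus_profile(2)[OF assms(2)]]
          comp[OF continuous_on_annulus_profile(3)[OF assms(2)]]) (use nz in auto)
  qed
  then have "bounded (H ` K)"
    unfolding K_def by (intro compact_imp_bounded compact_continuous_image compact_koranyi4_annulus)
  then obtain b where b: "\<forall>\<xi>\<in>K. \<bar>H \<xi>\<bar> \<le> b"
    unfolding bounded_iff by auto
  have "\<bar>L_H m (\<lambda>\<eta>. c * annulus_cutoff k j \<eta>) \<xi>\<bar> \<le> max 0 b * \<bar>c\<bar> * s (koranyi4 \<xi>) ^ (k - 2)"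
    for c and \<xi> :: "'n heisenberg"
  proof (cases "\<xi> \<in> K")
    case True
    have "0 \<le> s (koranyi4 \<xi>)" by (simp add: s_def)
    then have "\<bar>L_H m (\<lambda>\<eta>. c * annulus_cutoff k j \<eta>) \<xi>\<bar> = \<bar>H \<xi>\<bar> * (\<bar>c\<bar> * s (koranyi4 \<xi>) ^ (k - 2))"
      unfolding LH by (simp add: abs_mult)
    also have "\<dots> \<le> max 0 b * (\<bar>c\<bar> * s (koranyi4 \<xi>) ^ (k - 2))"
      using b True by (intro mult_right_mono) (auto simp: s_def)
    finally show ?thesis by (simp add: mult_ac)
  next
    case False
    then have "s (koranyi4 \<xi>) = 0"
      using annulus_cutoff_support(1)[OF assms(2), of 1 \<xi>] by (simp add: s_def K_def)
    then show ?thesis unfolding LH using k by simp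
  qed
  then show ?thesis unfolding s_def by (intro exI[of _ "max 0 b"]) auto
qed

section \<open>The time cutoff and its fractional integral\<close>

definition time_cutoff :: "nat \<Rightarrow> real \<Rightarrow> real \<Rightarrow> real"
  where "time_cutoff k T t = max 0 (1 - t / T) ^ k"

lemma time_cutoff_deriv:
  assumes "2 \<le> k"
  shows "(time_cutoff k T has_real_derivative - (real k / T) * max 0 (1 - t / T) ^ (k - 1)) (at t)"
proof -
  have "((\<lambda>t. 1 - t / T) has_real_derivative - (1 / T)) (at t)"
    by (cases "T = 0") (auto intro!: derivative_eq_intros)
  from DERIV_chain2[OF pos_part_power_deriv[OF assms] this] show ?thesis
    by (simp add: time_cutoff_def[abs_def])
qed

lemma has_bochner_integral_Beta:
  assumes "0 < a" and "1 \<le> k"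
  shows "has_bochner_integral lborel
    (\<lambda>s. indicator {0<..} s * (s powr (a - 1) * max 0 (1 - s) ^ k)) (Beta a (real k + 1))"
proof -
  let ?g = "\<lambda>s::real. s powr (a - 1) * (1 - s) powr (real k + 1 - 1)"
  have hi: "(?g has_integral Beta a (real k + 1)) {0..1}"
    using has_integral_Beta_real[of a "real k + 1"] assms by simp
  have "?g absolutely_integrable_on {0..1}"
    by (rule nonnegative_absolutely_integrable_1) (use hi in \<open>auto intro: has_integral_integrable\<close>)
  then have int: "set_integrable lebesgue {0..1} ?g" .
  have "(LINT s:{0..1}|lebesgue. ?g s) = Beta a (real k + 1)"
    using set_lebesgue_integral_eq_integral(2)[OF int] integral_unique[OF hi] by simp
  moreover have eq: "indicator {0..1} s *\<^sub>R ?g s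
      = indicator {0<..} s * (s powr (a - 1) * max 0 (1 - s) ^ k)" for s
  proof -
    consider "s \<le> 0" | "0 < s" "s < 1" | "s = 1" | "1 < s" by linarith
    then show ?thesis using assms(2) by cases (auto simp: powr_realpow zero_power)
  qed
  ultimately have "has_bochner_integral lebesgue
      (\<lambda>s. indicator {0<..} s * (s powr (a - 1) * max 0 (1 - s) ^ k)) (Beta a (real k + 1))"
    using int unfolding has_bochner_integral_iff set_integrable_def set_lebesgue_integral_def eq
    by blast
  moreover have "(\<lambda>s. indicator {0<..} s * (s powr (a - 1) * max 0 (1 - s) ^ k)) \<in> borel_measurable lborel"
    by measurable
  ultimately show ?thesis
    unfolding has_bochner_integral_iff by (simp add: integrable_completion integral_completion)
qed

text \<open>The substitution \<open>\<tau> = t + (T - t) s\<close> turns \<open>1 - \<tau>/T\<close> into \<open>(1 - t/T) (1 - s)\<close> and reduces the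
  integral to a Beta integral. It serves twice: with \<open>a = \<gamma>\<close> it is the fractional integral of the time
  profile, and with \<open>t = 0\<close>, \<open>a = \<alpha> + 1\<close> it is the time integral of the source term.\<close>

lemma has_bochner_integral_time_cutoff:
  assumes "0 < a" and "1 \<le> k" and "0 < T" and "t < T"
  shows "has_bochner_integral lborel
    (\<lambda>\<tau>. indicator {t<..} \<tau> * ((\<tau> - t) powr (a - 1) * time_cutoff k T \<tau>))
    (Beta a (real k + 1) * (T - t) powr a * time_cutoff k T t)"
    (is "has_bochner_integral lborel ?f ?I")
proof -
  have tT: "0 < 1 - t / T" "0 < T - t" using assms by auto
  have eq: "?f (t + (T - t) * s) = ((T - t) powr (a - 1) * time_cutoff k T t) *
     (indicator {0<..} s * (s powr (a - 1) * max 0 (1 - s) ^ k))" for s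
  proof (cases "0 < s")
    case True
    have "1 - (t + (T - t) * s) / T = (1 - t / T) * (1 - s)"
      using assms(3) by (simp add: field_simps)
    then have "max 0 (1 - (t + (T - t) * s) / T) = max 0 (1 - t / T) * max 0 (1 - s)"
      using tT by (auto simp: max_def zero_le_mult_iff mult_le_0_iff)
    then show ?thesis using True tT
      by (simp add: time_cutoff_def powr_mult power_mult_distrib)
  next
    case False
    then show ?thesis using tT by (simp add: mult_le_0_iff zero_less_mult_iff)
  qed
  have val: "?I /\<^sub>R \<bar>T - t\<bar> = ((T - t) powr (a - 1) * time_cutoff k T t) * Beta a (real k + 1)"
    using tT by (simp add: powr_diff field_simps)
  have "has_bochner_integral lborel (\<lambda>s. ?f (t + (T - t) * s)) (?I /\<^sub>R \<bar>T - t\<bar>)"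
    unfolding eq val
    by (intro has_bochner_integral_mult_right has_bochner_integral_Beta assms)
  then show ?thesis
    using tT lborel_has_bochner_integral_real_affine_iff[of "T - t" ?f ?I t] by simp
qed

lemma frac_int_time_cutoff:
  assumes "0 \<le> gam" and "1 \<le> k" and "0 < T" and "t < T"
  shows "frac_int \<infinity> gam (\<lambda>\<tau>. time_cutoff k T \<tau> * z) t =
    (if gam = 0 then 1 else Beta gam (real k + 1) / Gamma gam) * (T - t) powr gam * time_cutoff k T t * z"
proof (cases "gam = 0")
  case True
  then show ?thesis using assms by (simp add: frac_int_def)
next
  case False
  define J where "J \<tau> = indicator {t<..} \<tau> * ((\<tau> - t) powr (gam - 1) * time_cutoff k T \<tau>)" for \<tau>
  have J: "has_bochner_integral lborel J (Beta gam (real k + 1) * (T - t) powr gam * time_cutoff k T t)"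
    unfolding J_def by (rule has_bochner_integral_time_cutoff) (use False assms in auto)
  have "(LINT \<tau>:{\<tau>. t < \<tau> \<and> ereal \<tau> < \<infinity>}|lebesgue. (\<tau> - t) powr (gam - 1) * (time_cutoff k T \<tau> * z))
      = (LINT \<tau>|lebesgue. J \<tau> * z)"
    unfolding set_lebesgue_integral_def J_def
    by (intro Bochner_Integration.integral_cong) (auto simp: indicator_def)
  also have "\<dots> = (LINT \<tau>|lborel. J \<tau> * z)"
    using J by (intro integral_completion) (auto simp: has_bochner_integral_iff)
  also have "\<dots> = Beta gam (real k + 1) * (T - t) powr gam * time_cutoff k T t * z"
    using J by (simp add: has_bochner_integral_iff)
  finally show ?thesis using False by (simp add: frac_int_def)
qed

lemma frac_int_nonneg:
  assumes "0 \<le> gam" and "\<And>\<tau>. t \<le> \<tau> \<Longrightarrow> 0 \<le> h \<tau>"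
  shows "0 \<le> frac_int T gam h t"
proof -
  have "0 \<le> (LINT \<tau>:{\<tau>. t < \<tau> \<and> ereal \<tau> < T}|lebesgue. (\<tau> - t) powr (gam - 1) * h \<tau>)"
    unfolding set_lebesgue_integral_def
    by (rule Bochner_Integration.integral_nonneg) (auto simp: indicator_def assms)
  moreover have "0 \<le> 1 / Gamma gam" if "gam \<noteq> 0"
    using that assms(1) Gamma_real_pos[of gam] by simp
  ultimately show ?thesis using assms(2)[of t] by (auto simp: frac_int_def)
qed

text \<open>The exact value is a constant times \<open>(T - t)\<^sup>\<gamma> (1 - t/T)\<^sup>k\<close>. For \<open>T \<ge> 1\<close> one has
  \<open>T - t \<ge> 1 - t/T\<close>, and \<open>\<gamma> < 1\<close>, so the fractional integral costs at most one factor \<open>1 - t/T\<close>. The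
  constant does not depend on \<open>T\<close>, which is what makes the final comparison of powers of \<open>T\<close> possible.\<close>

lemma frac_int_time_cutoff_lower_bound:
  assumes "0 \<le> gam" and "gam < 1" and "1 \<le> k"
  shows "\<exists>c>0. \<forall>T t z. 1 \<le> T \<and> 0 \<le> t \<and> t < T \<and> 0 \<le> z \<longrightarrow>
    c * (1 - t / T) ^ (k + 1) * z \<le> frac_int \<infinity> gam (\<lambda>\<tau>. time_cutoff k T \<tau> * z) t"
proof -
  define c where "c = (if gam = 0 then 1 else Beta gam (real k + 1) / Gamma gam)"
  have c: "0 < c"
  proof (cases "gam = 0")
    case False
    then have "0 < gam" using assms(1) by simp
    then have "0 < Beta gam (real k + 1) / Gamma gam"
      unfolding Beta_def by (intro divide_pos_pos mult_pos_pos Gamma_real_pos) auto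
    then show ?thesis unfolding c_def if_not_P[OF False] .
  qed (simp add: c_def)
  have "c * (1 - t / T) ^ (k + 1) * z \<le> frac_int \<infinity> gam (\<lambda>\<tau>. time_cutoff k T \<tau> * z) t"
    if h: "1 \<le> T" "0 \<le> t" "t < T" "0 \<le> z" for T t z
  proof -
    define y where "y = 1 - t / T"
    have y: "0 < y" "y \<le> 1" using h by (auto simp: y_def)
    have "y \<le> y powr gam"
      using powr_mono'[of gam 1 y] y assms by simp
    also have "y \<le> T - t"
    proof -
      have "T * y = T - t" using h by (simp add: y_def field_simps)
      then show ?thesis using mult_right_mono[of 1 T y] h y by simp
    qed
    then have "y powr gam \<le> (T - t) powr gam"
      using y assms by (intro powr_mono2) auto
    finally have "c * y * (y ^ k * z) \<le> c * (T - t) powr gam * (y ^ k * z)"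
      using c y h by (intro mult_right_mono mult_left_mono) auto
    also have "\<dots> = frac_int \<infinity> gam (\<lambda>\<tau>. time_cutoff k T \<tau> * z) t"
      using frac_int_time_cutoff[OF assms(1,3), of T t z] h y
      by (simp add: c_def time_cutoff_def y_def)
    finally show ?thesis by (simp add: y_def mult_ac)
  qed
  then show ?thesis using c by blast
qed


section \<open>Absorbing the linear terms into the nonlinear one\<close>

lemma koranyi_powr_bounds:
  assumes "0 < j"
  obtains c C where "0 < c"
    and "\<And>\<xi>::'n::finite heisenberg. 1 / j \<le> koranyi4 \<xi> \<Longrightarrow> koranyi4 \<xi> \<le> j \<Longrightarrow>
      c \<le> koranyi \<xi> powr e \<and> koranyi \<xi> powr e \<le> C"
proof -
  have upper: "r powr q \<le> (1 / j) powr q + j powr q" if "1 / j \<le> r" "r \<le> j" for r q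
  proof -
    have j: "0 < 1 / j" using assms by simp
    then have r: "0 < 1 / j" "0 < r" using that by linarith+
    show ?thesis
    proof (cases "0 \<le> q")
      case True
      then have "r powr q \<le> j powr q" using r that by (intro powr_mono2) auto
      then show ?thesis using powr_ge_zero[of "1 / j" q] by linarith
    next
      case False
      then have "r powr q \<le> (1 / j) powr q" using r that by (intro powr_mono2') auto
      then show ?thesis using powr_ge_zero[of j q] by linarith
    qed
  qed
  define b where "b q = (1 / j) powr q + j powr q" for q
  have b: "0 < b q" for q using assms by (simp add: b_def add_pos_pos)
  show thesis
  proof (rule that[of "1 / b (- (e / 4))" "b (e / 4)"])
    fix \<xi> :: "'n heisenberg" assume \<xi>: "1 / j \<le> koranyi4 \<xi>" "koranyi4 \<xi> \<le> j"
    have "0 < 1 / j" using assms by simp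
    then have "koranyi4 \<xi> \<noteq> 0" using \<xi>(1) by linarith
    then have nz: "\<xi> \<noteq> 0" by simp
    have e: "koranyi \<xi> powr e = koranyi4 \<xi> powr (e / 4)" by (simp add: koranyi_koranyi4 powr_powr)
    have "1 / koranyi4 \<xi> powr (e / 4) \<le> b (- (e / 4))"
      using upper[OF \<xi>, of "- (e / 4)"]
      by (simp only: b_def powr_minus[of "koranyi4 \<xi>"] inverse_eq_divide)
    then have "1 / b (- (e / 4)) \<le> koranyi4 \<xi> powr (e / 4)"
      using le_imp_inverse_le[of "1 / koranyi4 \<xi> powr (e / 4)" "b (- (e / 4))"] nz
      by (simp add: inverse_eq_divide)
    moreover have "koranyi4 \<xi> powr (e / 4) \<le> b (e / 4)"
      unfolding b_def by (rule upper[OF \<xi>])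
    ultimately show "1 / b (- (e / 4)) \<le> koranyi \<xi> powr e \<and> koranyi \<xi> powr e \<le> b (e / 4)"
      unfolding e by (rule conjI)
  qed (use b in simp)
qed

text \<open>Young's inequality in the form needed for absorption. Beyond the point \<open>X\<^sub>0\<close> where
  \<open>c X\<^sup>p = a X\<close> the power dominates; up to it the linear term is at most \<open>a X\<^sub>0\<close>.\<close>

lemma linear_le_powr_plus_const:
  assumes "1 < p" and "0 < c" and "0 \<le> a"
  obtains M :: real where "0 \<le> M" and "\<And>X. 0 \<le> X \<Longrightarrow> a * X \<le> c * X powr p + M"
proof
  define X0 where "X0 = (a / c) powr (1 / (p - 1))"
  show "0 \<le> a * X0" using assms by (simp add: X0_def)
  fix X :: real assume X: "0 \<le> X"
  show "a * X \<le> c * X powr p + a * X0"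
  proof (cases "X \<le> X0")
    case True
    then have "a * X \<le> a * X0" using assms by (intro mult_left_mono) auto
    moreover have "0 \<le> c * X powr p" using assms by simp
    ultimately show ?thesis by linarith
  next
    case False
    then have "0 < X" using X assms by (smt (verit) X0_def powr_ge_zero)
    have "X0 powr (p - 1) \<le> X powr (p - 1)"
      using False assms by (intro powr_mono2) (auto simp: X0_def)
    then have "a / c \<le> X powr (p - 1)"
      using assms by (simp add: X0_def powr_powr)
    then have "a * X \<le> c * (X powr (p - 1) * X)"
      using assms \<open>0 < X\<close> by (simp add: field_simps)
    also have "X powr (p - 1) * X = X powr p"
      using \<open>0 < X\<close> by (simp add: powr_diff)
    finally show ?thesis using assms by (smt (verit) \<open>0 \<le> a * X0\<close>)
  qed
qed

lemma power_powr_le_power: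
  assumes "0 < x" "x \<le> 1" and "real i \<le> real l * p"
  shows "(x ^ l) powr p \<le> (x::real) ^ i"
proof -
  have "(x ^ l) powr p = x powr (real l * p)"
    using assms(1) by (simp add: powr_realpow[symmetric] powr_powr)
  also have "\<dots> \<le> x powr real i"
    using assms by (intro powr_mono') auto
  also have "\<dots> = x ^ i" using assms(1) by (simp add: powr_realpow)
  finally show ?thesis .
qed

lemma exponent_ge_3:
  assumes "1 < p" "2 * p \<le> real k * (p - 1)"
  shows "3 \<le> k"
proof (rule ccontr)
  assume "\<not> 3 \<le> k"
  then have "real k * (p - 1) \<le> 2 * (p - 1)" using assms(1) by (intro mult_right_mono) auto
  then show False using assms(2) by simp
qed

text \<open>The core estimate, in which \<open>a\<close> stands for the value \<open>v(t, \<xi>)\<close>. Put \<open>y = (1 - t/T)\<^sub>+\<close> and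
  \<open>s = \<sigma>\<^sub>+(\<xi>)\<close>, both in \<open>[0, 1]\<close>. The linear integrand is at most a constant times
  \<open>X = |a| y\<^sup>k\<^sup>-\<^sup>1 s\<^sup>k\<^sup>-\<^sup>2\<close>, and the nonlinear one is at least a constant times
  \<open>|a|\<^sup>p y\<^sup>k\<^sup>+\<^sup>1 s\<^sup>k\<close>. The condition on \<open>k\<close> says \<open>(k - 2) p \<ge> k\<close>, and it implies \<open>(k - 1) p \<ge> k + 1\<close>, so
  the latter dominates \<open>X\<^sup>p\<close> and the linear term is absorbed up to a constant.\<close>

lemma weak_form_pointwise_absorption:
  fixes m gam p j :: real and k :: nat
  assumes gam: "0 \<le> gam" "gam < 1" and p: "1 < p" and k: "2 * p \<le> real k * (p - 1)" and j: "0 < j"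
  shows "\<exists>C\<ge>0. \<forall>T t a. \<forall>\<xi>::'n::finite heisenberg. 1 \<le> T \<longrightarrow> 0 \<le> t \<longrightarrow>
      \<bar>a * (koranyi \<xi> powr (- 2 * m) * deriv (\<lambda>s. time_cutoff k T s * annulus_cutoff k j \<xi>) t
        - L_H m (\<lambda>\<eta>. time_cutoff k T t * annulus_cutoff k j \<eta>) \<xi>)\<bar>
      \<le> koranyi \<xi> powr (- (p + 1) * m) * \<bar>a\<bar> powr p
          * frac_int \<infinity> gam (\<lambda>s. time_cutoff k T s * annulus_cutoff k j \<xi>) t
        + C * (indicator {0..T} t * indicator {\<xi>. 1 / j \<le> koranyi4 \<xi> \<and> koranyi4 \<xi> \<le> j} \<xi>)"
proof -
  define K where "K = {\<xi>::'n heisenberg. 1 / j \<le> koranyi4 \<xi> \<and> koranyi4 \<xi> \<le> j}"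
  have k3: "3 \<le> k" using exponent_ge_3[OF p k] .
  have k1': "real (k - 1) = real k - 1" and k2': "real (k - 2) = real k - 2" using k3 by auto
  \<comment> \<open>The two exponent conditions that compare \<open>X\<^sup>p\<close> with the nonlinear integrand.\<close>
  have exp_s: "real k \<le> real (k - 2) * p" and exp_y: "real (k + 1) \<le> real (k - 1) * p"
    unfolding k1' k2' using k p by (simp_all add: algebra_simps)
  obtain CL where CL: "0 \<le> CL" and LH: "\<And>c. \<And>\<xi>::'n heisenberg.
      \<bar>L_H m (\<lambda>\<eta>. c * annulus_cutoff k j \<eta>) \<xi>\<bar>
      \<le> CL * \<bar>c\<bar> * max 0 (annulus_profile j (koranyi4 \<xi>)) ^ (k - 2)"
    using L_H_annulus_cutoff_bound[OF k3 j] by blast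
  obtain c1 C1 where C1: "\<And>\<xi>::'n heisenberg. \<xi> \<in> K \<Longrightarrow> koranyi \<xi> powr (- 2 * m) \<le> C1"
    unfolding K_def using koranyi_powr_bounds[OF j, of "- 2 * m"] by (metis (no_types, lifting) mem_Collect_eq)
  obtain c2 where c2: "0 < c2" "\<And>\<xi>::'n heisenberg. \<xi> \<in> K \<Longrightarrow> c2 \<le> koranyi \<xi> powr (- (p + 1) * m)"
    unfolding K_def using koranyi_powr_bounds[OF j, of "- (p + 1) * m"] by (metis (no_types, lifting) mem_Collect_eq)
  obtain c3 where c3: "0 < c3" and frac: "\<And>T t z. 1 \<le> T \<Longrightarrow> 0 \<le> t \<Longrightarrow> t < T \<Longrightarrow> 0 \<le> z \<Longrightarrow>
      c3 * (1 - t / T) ^ (k + 1) * z \<le> frac_int \<infinity> gam (\<lambda>\<tau>. time_cutoff k T \<tau> * z) t"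
    using frac_int_time_cutoff_lower_bound[OF gam, of k] k3 by auto
  define C2 where "C2 = max 0 C1 * real k + CL"
  obtain M where M: "0 \<le> M" "\<And>X. 0 \<le> X \<Longrightarrow> C2 * X \<le> (c2 * c3) * X powr p + M"
    using linear_le_powr_plus_const[OF p, of "c2 * c3" C2] c2(1) c3 CL by (auto simp: C2_def)
  show ?thesis
  proof (intro exI[of _ M] conjI M(1) allI impI, fold K_def)
    fix T t a :: real and \<xi> :: "'n heisenberg"
    assume T: "1 \<le> T" and t: "0 \<le> t"
    let ?A = "a * (koranyi \<xi> powr (- 2 * m) * deriv (\<lambda>s. time_cutoff k T s * annulus_cutoff k j \<xi>) t
        - L_H m (\<lambda>\<eta>. time_cutoff k T t * annulus_cutoff k j \<eta>) \<xi>)"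
    let ?F = "frac_int \<infinity> gam (\<lambda>s. time_cutoff k T s * annulus_cutoff k j \<xi>) t"
    let ?B = "koranyi \<xi> powr (- (p + 1) * m) * \<bar>a\<bar> powr p * ?F"
    define s where "s = max 0 (annulus_profile j (koranyi4 \<xi>))"
    define y where "y = max 0 (1 - t / T)"
    have ac: "annulus_cutoff k j \<xi> = s ^ k" by (simp add: annulus_cutoff_def s_def)
    have tc: "time_cutoff k T t = y ^ k" by (simp add: time_cutoff_def y_def)
    have s01: "0 \<le> s" "s \<le> 1" using annulus_profile_le_1[OF j] by (auto simp: s_def)
    have y01: "0 \<le> y" "y \<le> 1" using T t by (auto simp: y_def)
    have d: "deriv (\<lambda>s. time_cutoff k T s * annulus_cutoff k j \<xi>) t = - (real k / T) * y ^ (k - 1) * s ^ k"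
      unfolding ac y_def using k3 by (intro DERIV_imp_deriv DERIV_cmult_right time_cutoff_deriv) auto
    have L: "\<bar>L_H m (\<lambda>\<eta>. time_cutoff k T t * annulus_cutoff k j \<eta>) \<xi>\<bar> \<le> CL * y ^ k * s ^ (k - 2)"
      using LH[of "time_cutoff k T t" \<xi>] y01 unfolding tc s_def by simp
    have F0: "0 \<le> ?F"
      by (intro frac_int_nonneg gam mult_nonneg_nonneg) (auto simp: time_cutoff_def annulus_cutoff_def)
    then have B0: "0 \<le> ?B" by simp
    show "\<bar>?A\<bar> \<le> ?B + M * (indicator {0..T} t * indicator K \<xi>)"
    proof (cases "y = 0 \<or> s = 0")
      case True
      have "L_H m (\<lambda>\<eta>. time_cutoff k T t * annulus_cutoff k j \<eta>) \<xi> = 0"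
        using L True k3 by (auto simp: power_0_left)
      moreover have "deriv (\<lambda>s. time_cutoff k T s * annulus_cutoff k j \<xi>) t = 0"
        using d True k3 by (auto simp: power_0_left)
      moreover have "0 \<le> M * (indicator {0..T} t * indicator K \<xi>)" using M(1) by (simp add: indicator_def)
      ultimately show ?thesis using B0 by simp
    next
      case False
      then have y: "0 < y" and s: "0 < s" using y01 s01 by auto
      have tT: "t < T" and y': "y = 1 - t / T"
        using y T by (auto simp: y_def max_def field_simps split: if_splits)
      have \<xi>K: "\<xi> \<in> K"
        using annulus_cutoff_support(1)[OF j, of 1 \<xi>] s unfolding s_def K_def by force
      define X where "X = \<bar>a\<bar> * (y ^ (k - 1) * s ^ (k - 2))"
      have "\<bar>deriv (\<lambda>s. time_cutoff k T s * annulus_cutoff k j \<xi>) t\<bar> = (real k / T) * (y ^ (k - 1) * s ^ k)"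
        unfolding d using y s T by (simp add: abs_mult)
      also have "\<dots> \<le> real k * (y ^ (k - 1) * s ^ (k - 2))"
      proof (rule mult_mono)
        show "real k / T \<le> real k" using T mult_left_mono[OF T, of "real k"] by (simp add: field_simps)
        show "y ^ (k - 1) * s ^ k \<le> y ^ (k - 1) * s ^ (k - 2)"
          using y s s01 by (intro mult_left_mono power_decreasing) auto
      qed (use y s in auto)
      finally have d': "\<bar>deriv (\<lambda>s. time_cutoff k T s * annulus_cutoff k j \<xi>) t\<bar> \<le> real k * (y ^ (k - 1) * s ^ (k - 2))" .
      have w: "koranyi \<xi> powr (- 2 * m) \<le> max 0 C1" using C1[OF \<xi>K] by simp
      have "CL * y ^ k * s ^ (k - 2) \<le> CL * (y ^ (k - 1) * s ^ (k - 2))"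
        unfolding mult.assoc using CL y y01 s
        by (intro mult_left_mono mult_right_mono power_decreasing) auto
      then have L': "\<bar>L_H m (\<lambda>\<eta>. time_cutoff k T t * annulus_cutoff k j \<eta>) \<xi>\<bar> \<le> CL * (y ^ (k - 1) * s ^ (k - 2))"
        using L by linarith
      have "\<bar>koranyi \<xi> powr (- 2 * m) * deriv (\<lambda>s. time_cutoff k T s * annulus_cutoff k j \<xi>) t
          - L_H m (\<lambda>\<eta>. time_cutoff k T t * annulus_cutoff k j \<eta>) \<xi>\<bar>
          \<le> koranyi \<xi> powr (- 2 * m) * \<bar>deriv (\<lambda>s. time_cutoff k T s * annulus_cutoff k j \<xi>) t\<bar>
            + \<bar>L_H m (\<lambda>\<eta>. time_cutoff k T t * annulus_cutoff k j \<eta>) \<xi>\<bar>"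
        by (rule order_trans[OF abs_triangle_ineq4]) (simp add: abs_mult)
      also have "\<dots> \<le> max 0 C1 * (real k * (y ^ (k - 1) * s ^ (k - 2))) + CL * (y ^ (k - 1) * s ^ (k - 2))"
        using w d' L' by (intro add_mono mult_mono) auto
      finally have "\<bar>?A\<bar> \<le> \<bar>a\<bar> * (max 0 C1 * (real k * (y ^ (k - 1) * s ^ (k - 2))) + CL * (y ^ (k - 1) * s ^ (k - 2)))"
        unfolding abs_mult[of a] by (rule mult_left_mono) simp
      also have "\<dots> = C2 * X"
        by (simp add: C2_def X_def algebra_simps)
      also have "\<dots> \<le> (c2 * c3) * X powr p + M"
        by (rule M(2)) (use y s in \<open>simp add: X_def\<close>)
      also have "X powr p \<le> \<bar>a\<bar> powr p * (y ^ (k + 1) * s ^ k)"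
        unfolding X_def using y s y01 s01
        by (simp only: powr_mult, intro mult_left_mono mult_mono power_powr_le_power exp_s exp_y) auto
      then have "(c2 * c3) * X powr p \<le> (c2 * \<bar>a\<bar> powr p) * (c3 * y ^ (k + 1) * s ^ k)"
        using c2(1) c3 by (simp add: mult_ac)
      also have "\<dots> \<le> (koranyi \<xi> powr (- (p + 1) * m) * \<bar>a\<bar> powr p) * ?F"
        using c2 c3 y s frac[OF T t tT, of "s ^ k"] \<xi>K unfolding ac y'
        by (intro mult_mono mult_right_mono) auto
      finally show ?thesis using \<xi>K t tT by simp
    qed
  qed
qed


section \<open>Lebesgue integrals of tensor products\<close>

lemma ex_borel_AE_eq_integrable:
  fixes g :: "'a::euclidean_space \<Rightarrow> real"
  assumes "integrable lebesgue g"
  shows "\<exists>g'. integrable lborel g' \<and> (AE x in lborel. g x = g' x)"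
proof -
  obtain g' where "g' \<in> borel_measurable lborel" "AE x in lborel. g x = g' x"
    using completion_ex_borel_measurable_real[of g lborel] assms by auto
  moreover have "integrable lebesgue g'"
    by (rule integrable_cong_AE_imp[OF assms]) (use calculation in \<open>auto intro: AE_completion measurable_completion\<close>)
  ultimately show ?thesis by (auto simp: integrable_completion)
qed

text \<open>In a complete measure space every set that differs from a measurable one by a null set is
  measurable.\<close>

lemma borel_measurable_completion_AE:
  assumes "f \<in> borel_measurable (completion M)" and "AE x in completion M. f x = g x"
  shows "g \<in> borel_measurable (completion M)"
proof (rule measurableI)
  fix A :: "'b::topological_space set" assume "A \<in> sets borel"
  then have "f -` A \<inter> space (completion M) \<in> sets (completion M)"
    using assms(1) by (rule measurable_sets[rotated])
  then show "g -` A \<inter> space (completion M) \<in> sets (completion M)"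
    by (rule completion.in_sets_AE[rotated]) (use assms(2) in \<open>auto elim!: eventually_mono\<close>)
qed simp

text \<open>Fubini's theorem is available for the product of the two Borel-Lebesgue measures, whose completion
  is Lebesgue measure on the product space. As \<open>g\<close> is only Lebesgue measurable, it is replaced by a
  Borel function that agrees with it off a null set \<open>N\<close>; the tensor products then agree off the null
  set \<open>UNIV \<times> N\<close>.\<close>

lemma has_bochner_integral_lebesgue_tensor:
  fixes a :: "real \<Rightarrow> real" and g :: "'a::euclidean_space \<Rightarrow> real"
  assumes a: "has_bochner_integral lborel a A" and g: "integrable lebesgue g"
  shows "has_bochner_integral lebesgue (\<lambda>(t, x). a t * g x) (A * (LINT x|lebesgue. g x))"
proof -
  obtain g' where g': "integrable lborel g'" and eq: "AE x in lborel. g x = g' x"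
    using ex_borel_AE_eq_integrable[OF g] by blast
  have G: "(LINT x|lebesgue. g x) = (LINT x|lborel. g' x)"
  proof -
    have "(LINT x|lebesgue. g x) = (LINT x|lebesgue. g' x)"
      by (rule integral_cong_AE) (use g g' eq in \<open>auto intro: AE_completion measurable_completion\<close>)
    then show ?thesis using g' by (simp add: integral_completion)
  qed
  have aint: "integrable lborel a" and A: "A = (LINT t|lborel. a t)"
    using a by (auto simp: has_bochner_integral_iff)
  have meas: "(\<lambda>(t, x). a t * g' x) \<in> borel_measurable (lborel \<Otimes>\<^sub>M lborel)"
    using aint g' by measurable
  have int: "integrable (lborel \<Otimes>\<^sub>M lborel) (\<lambda>(t, x). a t * g' x)"
    by (rule lborel_pair.Fubini_integrable) (use meas aint g' in \<open>auto simp: abs_mult\<close>)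
  have "integral\<^sup>L (lborel \<Otimes>\<^sub>M lborel) (\<lambda>(t, x). a t * g' x) = A * (LINT x|lborel. g' x)"
    using lborel_pair.integral_fst'[OF int] by (simp add: A)
  then have hb: "has_bochner_integral lborel (\<lambda>(t, x). a t * g' x) (A * (LINT x|lborel. g' x))"
    using int by (simp add: has_bochner_integral_iff lborel_prod)
  then have hb': "has_bochner_integral lebesgue (\<lambda>(t, x). a t * g' x) (A * (LINT x|lborel. g' x))"
    by (auto simp: has_bochner_integral_iff integrable_completion integral_completion)
  obtain N where N: "N \<in> null_sets lborel" "{x. g x \<noteq> g' x} \<subseteq> N"
    using eq by (auto simp: eventually_ae_filter)
  have "UNIV \<times> N \<in> null_sets (lborel \<Otimes>\<^sub>M lborel :: (real \<times> 'a) measure)"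
    using N(1) by (auto intro!: lborel.times_in_null_sets2)
  then have "UNIV \<times> N \<in> null_sets (lborel :: (real \<times> 'a) measure)" by (simp add: lborel_prod)
  then have "AE z in lborel. (\<lambda>(t, x). a t * g x) z = (\<lambda>(t, x). a t * g' x) (z :: real \<times> 'a)"
    by (rule AE_I') (use N(2) in auto)
  then have ae: "AE z in lebesgue. (\<lambda>(t, x). a t * g' x) z = (\<lambda>(t, x). a t * g x) (z :: real \<times> 'a)"
    by (intro AE_completion) auto
  have gm: "(\<lambda>(t, x). a t * g x) \<in> borel_measurable (lebesgue :: (real \<times> 'a) measure)"
    using hb' by (intro borel_measurable_completion_AE[OF _ ae]) (auto simp: has_bochner_integral_iff)
  show ?thesis
    unfolding G using has_bochner_integral_cong_AE[OF _ gm ae] hb'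
    by (simp add: has_bochner_integral_iff)
qed

section \<open>Nonexistence\<close>

lemma integrable_mult_annulus_cutoff:
  fixes g :: "'n::finite heisenberg \<Rightarrow> real"
  assumes "integrable lebesgue g" "3 \<le> k" "0 < j"
  shows "integrable lebesgue (\<lambda>\<xi>. g \<xi> * annulus_cutoff k j \<xi>)"
proof (rule Bochner_Integration.integrable_bound[OF assms(1)])
  have "(annulus_cutoff k j :: 'n heisenberg \<Rightarrow> real) \<in> borel_measurable lebesgue"
    using borel_measurable_continuous_onI[OF C2_fun_annulus_cutoff(2)[OF assms(2,3)]]
    by (intro measurable_completion) simp
  then show "(\<lambda>\<xi>. g \<xi> * annulus_cutoff k j \<xi>) \<in> borel_measurable lebesgue"
    using assms(1) by (intro borel_measurable_times) auto
  have "0 \<le> annulus_cutoff k j \<xi>" "annulus_cutoff k j \<xi> \<le> 1" for \<xi> :: "'n heisenberg"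
    using annulus_profile_le_1[OF assms(3)] by (auto simp: annulus_cutoff_def intro!: power_le_one)
  then show "AE \<xi> in lebesgue. norm (g \<xi> * annulus_cutoff k j \<xi>) \<le> norm (g \<xi>)"
    by (intro AE_I2) (auto simp: abs_mult mult_left_le)
qed

text \<open>Dominated convergence along \<open>j \<rightarrow> \<infinity>\<close>. The cutoffs vanish at the origin for every \<open>j\<close>, hence the
  condition \<open>g 0 = 0\<close>, which makes the convergence hold everywhere.\<close>

lemma annulus_cutoff_exhausts_integral:
  fixes g :: "'n::finite heisenberg \<Rightarrow> real"
  assumes g: "integrable lebesgue g" "g 0 = 0" "0 < (LINT \<xi>|lebesgue. g \<xi>)" and k: "3 \<le> k"
  obtains j where "0 < j" "0 < (LINT \<xi>|lebesgue. g \<xi> * annulus_cutoff k j \<xi>)"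
proof -
  have "(\<lambda>n. LINT \<xi>|lebesgue. g \<xi> * annulus_cutoff k (real (Suc n)) \<xi>) \<longlonglongrightarrow> (LINT \<xi>|lebesgue. g \<xi>)"
  proof (rule integral_dominated_convergence[where w="\<lambda>\<xi>. norm (g \<xi>)"])
    show "(\<lambda>\<xi>. g \<xi> * annulus_cutoff k (real (Suc n)) \<xi>) \<in> borel_measurable lebesgue" for n
      using integrable_mult_annulus_cutoff[OF g(1) k, of "real (Suc n)"] by auto
    show "AE \<xi> in lebesgue. (\<lambda>n. g \<xi> * annulus_cutoff k (real (Suc n)) \<xi>) \<longlonglongrightarrow> g \<xi>"
    proof (rule AE_I2)
      fix \<xi> :: "'n heisenberg"
      show "(\<lambda>n. g \<xi> * annulus_cutoff k (real (Suc n)) \<xi>) \<longlonglongrightarrow> g \<xi>"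
      proof (cases "\<xi> = 0")
        case False
        then have "0 < koranyi4 \<xi>" using koranyi4_nonneg[of \<xi>] koranyi4_eq_0_iff[of \<xi>] by linarith
        from LIMSEQ_Suc[OF annulus_profile_tendsto[OF this]]
        have "(\<lambda>n. g \<xi> * annulus_cutoff k (real (Suc n)) \<xi>) \<longlonglongrightarrow> g \<xi> * max 0 1 ^ k"
          unfolding annulus_cutoff_def by (intro tendsto_intros)
        then show ?thesis by simp
      qed (simp add: g(2))
    qed
    have "0 \<le> annulus_cutoff k (real (Suc n)) \<xi>" "annulus_cutoff k (real (Suc n)) \<xi> \<le> 1" for n and \<xi> :: "'n heisenberg"
      using annulus_profile_le_1[of "real (Suc n)"] by (auto simp: annulus_cutoff_def intro!: power_le_one)
    then show "AE \<xi> in lebesgue. norm (g \<xi> * annulus_cutoff k (real (Suc n)) \<xi>) \<le> norm (g \<xi>)" for n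
      by (intro AE_I2) (auto simp: abs_mult mult_left_le)
  qed (use g(1) in auto)
  then have "\<forall>\<^sub>F n in sequentially. 0 < (LINT \<xi>|lebesgue. g \<xi> * annulus_cutoff k (real (Suc n)) \<xi>)"
    using g(3) order_tendstoD(1) by blast
  then obtain n where "0 < (LINT \<xi>|lebesgue. g \<xi> * annulus_cutoff k (real (Suc n)) \<xi>)"
    using eventually_sequentially by auto
  then show thesis by (intro that[of "real (Suc n)"]) auto
qed

lemma superlinear_not_le_linear:
  fixes b U C :: real
  assumes "0 < alpha" "0 < b"
  shows "\<exists>T\<ge>1. C * T < b * T powr (alpha + 1) + U"
proof -
  define R where "R = (\<bar>C\<bar> + \<bar>U\<bar>) / b + 1"
  \<comment> \<open>Chosen so that \<open>b T\<^sup>\<alpha> = |C| + |U| + b\<close>.\<close>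
  define T where "T = R powr (1 / alpha)"
  have R: "1 \<le> R" using assms by (simp add: R_def)
  have T: "1 \<le> T" unfolding T_def using R assms by (intro ge_one_powr_ge_zero) auto
  have "T powr alpha = R" using R assms by (simp add: T_def powr_powr)
  then have "b * T powr (alpha + 1) = (\<bar>C\<bar> + \<bar>U\<bar> + b) * T"
    using T assms by (simp add: powr_add R_def field_simps)
  moreover have "\<bar>U\<bar> \<le> \<bar>U\<bar> * T" using mult_left_mono[OF T, of "\<bar>U\<bar>"] by simp
  moreover have "C * T \<le> \<bar>C\<bar> * T" "0 < b * T"
    using T assms by (auto intro!: mult_right_mono)
  moreover have "- U \<le> \<bar>U\<bar>" by simp
  ultimately have "C * T < b * T powr (alpha + 1) + U" by (simp add: distrib_right)
  then show ?thesis using T by blast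
qed

theorem theorem1p2:
  fixes u0 f :: "'n::finite heisenberg \<Rightarrow> real" and lam gam alpha :: real
  assumes "0 < lam" and "lam < ((real (homdim TYPE('n)) - 2) / 2)\<^sup>2"
    and "0 \<le> gam" and "gam < 1" and "0 < alpha"
    and "integrable lebesgue (\<lambda>\<xi>. koranyi \<xi> powr (- mu (homdim TYPE('n)) lam) * u0 \<xi>)"
    and "integrable lebesgue (\<lambda>\<xi>. koranyi \<xi> powr (- mu (homdim TYPE('n)) lam) * f \<xi>)"
    and "0 < (LINT \<xi>|lebesgue. koranyi \<xi> powr (- mu (homdim TYPE('n)) lam) * f \<xi>)"
  shows "\<forall>p>1. \<not> (\<exists>u. global_weak_solution lam gam alpha p f u0 u)"
proof (intro allI impI notI)
  fix p :: real assume p: "1 < p"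
  assume "\<exists>u. global_weak_solution lam gam alpha p f u0 u"
  then obtain u where sol: "global_weak_solution lam gam alpha p f u0 u" by blast
  define m where "m = mu (homdim TYPE('n)) lam"
  define v where "v t \<xi> = koranyi \<xi> powr m * u t \<xi>" for t \<xi>
  define g where "g \<xi> = koranyi \<xi> powr (- m) * f \<xi>" for \<xi>
  obtain k :: nat where "2 * p / (p - 1) \<le> real k" using real_arch_simple by blast
  then have k: "2 * p \<le> real k * (p - 1)" using p by (simp add: field_simps)
  have k3: "3 \<le> k" using exponent_ge_3[OF p k] .
  \<comment> \<open>The value at the origin is \<open>0\<close> because \<open>0 powr q = 0\<close>.\<close>
  have g: "integrable lebesgue g" "g 0 = 0" "0 < (LINT \<xi>|lebesgue. g \<xi>)"
    using assms(7,8) unfolding g_def m_def by (auto simp: koranyi_koranyi4)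
  obtain j where j: "0 < j" and F: "0 < (LINT \<xi>|lebesgue. g \<xi> * annulus_cutoff k j \<xi>)"
    using annulus_cutoff_exhausts_integral[OF g k3] by blast
  define F where "F = (LINT \<xi>|lebesgue. g \<xi> * annulus_cutoff k j \<xi>)"
  define U where "U = (LINT \<xi>|lebesgue. koranyi \<xi> powr (- 2 * m) * (koranyi \<xi> powr m * u0 \<xi>) * annulus_cutoff k j \<xi>)"
  define K where "K = {\<xi>::'n heisenberg. 1 / j \<le> koranyi4 \<xi> \<and> koranyi4 \<xi> \<le> j}"
  define b where "b = Beta (alpha + 1) (real k + 1)"
  have b: "0 < b" unfolding b_def Beta_def using assms(5)
    by (intro divide_pos_pos mult_pos_pos Gamma_real_pos) auto
  obtain C where C: "0 \<le> C"
    and bound: "\<forall>T t a. \<forall>\<xi>::'n heisenberg. 1 \<le> T \<longrightarrow> 0 \<le> t \<longrightarrow>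
      \<bar>a * (koranyi \<xi> powr (- 2 * m) * deriv (\<lambda>s. time_cutoff k T s * annulus_cutoff k j \<xi>) t
        - L_H m (\<lambda>\<eta>. time_cutoff k T t * annulus_cutoff k j \<eta>) \<xi>)\<bar>
      \<le> koranyi \<xi> powr (- (p + 1) * m) * \<bar>a\<bar> powr p
          * frac_int \<infinity> gam (\<lambda>s. time_cutoff k T s * annulus_cutoff k j \<xi>) t
        + C * (indicator {0..T} t * indicator K \<xi>)"
    using weak_form_pointwise_absorption[OF assms(3,4) p k j, where m = m and 'n = 'n, folded K_def]
    by (elim exE conjE) (rule that)
  have compK: "compact K" unfolding K_def by (rule compact_koranyi4_annulus)
  have intK: "integrable lebesgue (indicator K :: 'n heisenberg \<Rightarrow> real)"
    using lmeasurable_compact[OF compK] by (intro integrable_real_indicator) (auto simp: fmeasurable_def)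
  define V where "V = (LINT \<xi>|lebesgue. indicator K \<xi> :: real)"
  have ineq: "b * F * T powr (alpha + 1) + U \<le> C * V * T" if T: "1 \<le> T" for T
  proof -
    define \<phi> where "\<phi> = (\<lambda>t \<xi>. time_cutoff k T t * annulus_cutoff k j (\<xi>::'n heisenberg))"
    define D where "D = {t::real. 0 < t \<and> ereal t < \<infinity>} \<times> (UNIV :: 'n heisenberg set)"
    define A where "A = (\<lambda>(t, \<xi>). v t \<xi> *
                 (koranyi \<xi> powr (- 2 * m) * deriv (\<lambda>s. \<phi> s \<xi>) t - L_H m (\<phi> t) \<xi>))"
    define B where "B = (\<lambda>(t, \<xi>). koranyi \<xi> powr (- (p + 1) * m) * \<bar>v t \<xi>\<bar> powr p *
                 frac_int \<infinity> gam (\<lambda>s. \<phi> s \<xi>) t)"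
    have "test_function \<infinity> \<phi>"
      unfolding \<phi>_def
    proof (rule test_function_product[OF C2_fun_annulus_cutoff[OF k3 j] compK])
      show "annulus_cutoff k j \<xi> = 0" if "\<xi> \<notin> K" for \<xi>
        using annulus_cutoff_support(2)[OF j, of k \<xi>] k3 that by (simp add: K_def)
      show "(time_cutoff k T has_real_derivative - (real k / T) * max 0 (1 - t / T) ^ (k - 1)) (at t)" for t
        using k3 by (intro time_cutoff_deriv) simp
      show "isCont (\<lambda>t. - (real k / T) * max 0 (1 - t / T) ^ (k - 1)) t" for t
        using T by (intro continuous_intros) auto
      show "time_cutoff k T t = 0" if "T < t" for t
        using that T k3 by (simp add: time_cutoff_def max_def)
    qed
    moreover have "0 \<le> \<phi> t \<xi>" for t \<xi>
      by (simp add: \<phi>_def time_cutoff_def annulus_cutoff_def)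
    moreover have "\<And>\<phi>. test_function \<infinity> \<phi> \<and> (\<forall>t \<xi>. 0 \<le> t \<and> ereal t < \<infinity> \<longrightarrow> 0 \<le> \<phi> t \<xi>) \<Longrightarrow>
      (let D = {t. 0 < t \<and> ereal t < \<infinity>} \<times> UNIV;
           A = (\<lambda>(t, \<xi>). v t \<xi> *
                 (koranyi \<xi> powr (- 2 * m) * deriv (\<lambda>s. \<phi> s \<xi>) t - L_H m (\<phi> t) \<xi>));
           B = (\<lambda>(t, \<xi>). koranyi \<xi> powr (- (p + 1) * m) * \<bar>v t \<xi>\<bar> powr p *
                 frac_int \<infinity> gam (\<lambda>s. \<phi> s \<xi>) t)
       in set_integrable lebesgue D A \<and> set_integrable lebesgue D B \<and>
          - (LINT z:D|lebesgue. A z) =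
            (LINT z:D|lebesgue. B z) +
            (LINT \<xi>|lebesgue. koranyi \<xi> powr (- 2 * m) * (koranyi \<xi> powr m * u0 \<xi>) * \<phi> 0 \<xi>) +
            (LINT (t, \<xi>):D|lebesgue. koranyi \<xi> powr (- m) * t powr alpha * f \<xi> * \<phi> t \<xi>))"
      using sol unfolding global_weak_solution_def weak_solution_def weak_solution_v_def v_def m_def
      unfolding Let_def by blast
    ultimately have A: "set_integrable lebesgue D A" and B: "set_integrable lebesgue D B"
      and eq: "- (LINT z:D|lebesgue. A z) = (LINT z:D|lebesgue. B z) +
            (LINT \<xi>|lebesgue. koranyi \<xi> powr (- 2 * m) * (koranyi \<xi> powr m * u0 \<xi>) * \<phi> 0 \<xi>) +
            (LINT (t, \<xi>):D|lebesgue. koranyi \<xi> powr (- m) * t powr alpha * f \<xi> * \<phi> t \<xi>)"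
      unfolding Let_def D_def[symmetric] A_def[symmetric] B_def[symmetric]
      unfolding A_def B_def D_def by blast+
    have initial: "(LINT \<xi>|lebesgue. koranyi \<xi> powr (- 2 * m) * (koranyi \<xi> powr m * u0 \<xi>) * \<phi> 0 \<xi>) = U"
      by (simp add: U_def \<phi>_def time_cutoff_def)
    \<comment> \<open>The written-out zeros match the general formula at starting time \<open>0\<close> and exponent \<open>\<alpha> + 1\<close>.\<close>
    define \<eta> where "\<eta> t = indicator {0<..} t * ((t - 0) powr (alpha + 1 - 1) * time_cutoff k T t)" for t
    have "has_bochner_integral lborel \<eta> (b * (T - 0) powr (alpha + 1) * time_cutoff k T 0)"
      unfolding \<eta>_def b_def using assms(5) k3 T by (intro has_bochner_integral_time_cutoff) auto
    then have \<eta>: "has_bochner_integral lborel \<eta> (b * T powr (alpha + 1))"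
      by (simp add: time_cutoff_def)
    have "(LINT (t, \<xi>):D|lebesgue. koranyi \<xi> powr (- m) * t powr alpha * f \<xi> * \<phi> t \<xi>)
        = (LINT z|lebesgue. (\<lambda>(t, \<xi>). \<eta> t * (g \<xi> * annulus_cutoff k j \<xi>)) z)"
      unfolding set_lebesgue_integral_def
      by (intro Bochner_Integration.integral_cong)
         (auto simp: D_def \<eta>_def g_def \<phi>_def indicator_def)
    also have "\<dots> = b * T powr (alpha + 1) * F"
      using has_bochner_integral_lebesgue_tensor[OF \<eta> integrable_mult_annulus_cutoff[OF g(1) k3 j]]
      unfolding F_def by (simp add: has_bochner_integral_iff)
    finally have source: "(LINT (t, \<xi>):D|lebesgue. koranyi \<xi> powr (- m) * t powr alpha * f \<xi> * \<phi> t \<xi>)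
        = b * T powr (alpha + 1) * F" .
    \<comment> \<open>The error term left by the absorption; its integral grows only linearly in \<open>T\<close>.\<close>
    define h where "h = (\<lambda>(t, \<xi>). indicator {0..T} t * indicator K \<xi> :: real)"
    have "has_bochner_integral lborel (indicator {0..T}) T"
      using T has_bochner_integral_real_indicator[of "{0..T}" lborel] by simp
    from has_bochner_integral_lebesgue_tensor[OF this intK]
    have h: "has_bochner_integral lebesgue h (T * V)" unfolding h_def V_def .
    have "- (LINT z:D|lebesgue. A z) = (LINT z|lebesgue. - (indicator D z * A z))"
      unfolding set_lebesgue_integral_def by simp
    also have "\<dots> \<le> (LINT z|lebesgue. indicator D z * B z + C * h z)"
    proof (rule integral_mono)
      show "integrable lebesgue (\<lambda>z. - (indicator D z * A z))"
        using A unfolding set_integrable_def by simp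
      show "integrable lebesgue (\<lambda>z. indicator D z * B z + C * h z)"
        using B h unfolding set_integrable_def has_bochner_integral_iff by simp
      fix z :: "real \<times> 'n heisenberg"
      obtain t \<xi> where z: "z = (t, \<xi>)" by (cases z)
      show "- (indicator D z * A z) \<le> indicator D z * B z + C * h z"
      proof (cases "0 < t")
        case True
        then show ?thesis
          using bound[rule_format, OF T, of t "v t \<xi>" \<xi>] unfolding z A_def B_def h_def \<phi>_def
          by (simp add: D_def)
      next
        case False
        then show ?thesis using C by (simp add: z D_def h_def indicator_def)
      qed
    qed
    also have "\<dots> = (LINT z:D|lebesgue. B z) + C * (T * V)"
      using B h unfolding set_integrable_def set_lebesgue_integral_def has_bochner_integral_iff by simp
    finally show ?thesis unfolding eq initial source by (simp add: mult_ac)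
  qed
  obtain T where "1 \<le> T" "C * V * T < b * F * T powr (alpha + 1) + U"
    using superlinear_not_le_linear[OF assms(5), of "b * F" "C * V" U] b F by (auto simp: F_def)
  with ineq[of T] show False by linarith
qed

end
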